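(* Fix $\tau>0$ and consider the full-memory modified BFGS method (in any of the modes N, E, H) for $\Phi_\tau$ with the fixed initial matrix $H^{(0)}=\chi_0P(z^0,\tau)^{-1}$; the preconditioner is not reinitialized at later iterations. Let $(z_k)_{k\ge0}$ be an infinite sequence it generates. Let $U\subseteq\mathbb R^{n+1}$ be a convex neighborhood, let $z^*\in U$ satisfy $\nabla\Phi_\tau(z^* )=0$, and suppose $m_\Phi I\preceq\nabla^2\Phi_\tau(z)\preceq M_\Phi I$ for every $z\in U$, where $0<m_\Phi\le M_\Phi$. Assume that, from some index onward, all iterates, all trial segments and all accepted segments $[z_k,z_{k+1}]$ lie in $U$, that $\nabla^2\Phi_\tau$ is locally Lipschitz on $U$, and that $$0<m_{\rm cur}<m_\Phi,\qquad M_{\rm cur}>M_\Phi^2/m_\Phi.$$ Then all sufficiently late pairs $(s_k,y_k)$ pass the direct positive-curvature test $s_k^Ty_k>\max\{m_{\rm cur}\|s_k\|^2,\|y_k\|^2/M_{\rm cur}\}$, and the N, E and H corrections are inactive. If, in addition, unit steps are eventually accepted, then $(z_k)$ converges Q-superlinearly to $z^*$.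
   Context: Let $f_1,\dots,f_m:\mathbb R^n\to\mathbb R$ be differentiable. For $\tau>0$ put $\phi_\tau(r)=\frac{r+\sqrt{r^2+\tau^2}}{2}$ and $\Phi_\tau(x,t)=t+\sum_{i=1}^m\phi_\tau(f_i(x)-t)$, $(x,t)\in\mathbb R^n\times\mathbb R$. For $z=(x,t)$ put $q_i(x)=(\nabla f_i(x)^T,-1)^T$, $\omega_i=((f_i(x)-t)^2+\tau^2)^{1/2}$, let $J(z)\in\mathbb R^{m\times(n+1)}$ have rows $q_i(x)^T$, $\Pi_x=\begin{pmatrix}I_n&0\\0&0\end{pmatrix}$, $D^{\rm hyp}(z,\tau)=\operatorname{diag}(\omega_1^{-1},\dots,\omega_m^{-1})$, and $P(z,\tau)=\delta I_{n+1}+\bar L\Pi_x+\frac12J(z)^TD^{\rm hyp}(z,\tau)J(z)$ with fixed $\delta>0$ and $\bar L=\sum_iL_i$, where $L_i\ge0$ is a Lipschitz constant of $\nabla f_i$ on a set containing the iterates and trial segments. So $P(z,\tau)$ is symmetric positive definite. Also $\chi_0>0$ and $0<m_{\rm cur}<M_{\rm cur}$ are fixed. Full-memory modified BFGS method. Start from $z_0=z^0$ and $H_0=H^{(0)}$. At $z_k$ with $g_k=\nabla\Phi_\tau(z_k)\neq0$, put $d_k=-H_kg_k$; starting from the unit trial step, backtrack by a factor $\beta\in(0,1)$ until $\Phi_\tau(z_k+\lambda d_k)\le\Phi_\tau(z_k)+\alpha\lambda g_k^Td_k$ with $0<\alpha<1$; the trial segments are those from $z_k$ to the tested points. Set $z_{k+1}=z_k+\lambda_kd_k$,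 $s_k=z_{k+1}-z_k$, $y_k=\nabla\Phi_\tau(z_{k+1})-g_k$, $c=s_k^Ty_k$, $\eta=\max\{m_{\rm cur}\|s_k\|^2,\|y_k\|^2/M_{\rm cur}\}$, $B_k=H_k^{-1}$. If $c>\eta$ use $\widetilde y_k=y_k$ (direct positive-curvature test). In mode N, if $c<-\eta$, use $\widetilde y_k=-y_k$; in mode E, if $c<-\eta$, use $\widetilde y_k=y_k-2c\,s_k/(s_k^Ts_k)$; in mode H, if $c<-m_{\rm cur}\|s_k\|^2$, form $\widetilde y_k=y_k-2c\,B_ks_k/(s_k^TB_ks_k)$ and use it if $\|\widetilde y_k\|^2<M_{\rm cur}|c|$. Otherwise the pair is skipped and $H_{k+1}=H_k$. If a vector $\widetilde y_k$ is used, with $\rho_k=(s_k^T\widetilde y_k)^{-1}$, $H_{k+1}=(I-\rho_ks_k\widetilde y_k^T)H_k(I-\rho_k\widetilde y_ks_k^T)+\rho_ks_ks_k^T$. All pairs are retained (no memory limit). A correction is "inactive" at $k$ if $\widetilde y_k=y_k$ is used. Q-superlinear convergence means $z_k\to z^*$ and $\|z_{k+1}-z^*\|/\|z_k-z^*\|\to0$. *)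

theory Defs
  imports "HOL-Analysis.Analysis"
begin

definition grad :: "('a::real_inner \<Rightarrow> real) \<Rightarrow> 'a \<Rightarrow> 'a" where
  "grad F x = (THE D. GDERIV F x :> D)"

text \<open>Only meaningful at points where \<open>grad F\<close> is differentiable; this is stated separately
  wherever it is assumed.\<close>

definition hess :: "(real^'d \<Rightarrow> real) \<Rightarrow> real^'d \<Rightarrow> real^'d^'d" where
  "hess F z = matrix (frechet_derivative (grad F) (at z))"

definition psd :: "real^'d^'d \<Rightarrow> bool" where
  "psd A \<longleftrightarrow> transpose A = A \<and> (\<forall>v. 0 \<le> v \<bullet> (A *v v))"

definition loewner_le :: "real^'d^'d \<Rightarrow> real^'d^'d \<Rightarrow> bool" where
  "loewner_le A B \<longleftrightarrow> psd (B - A)"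

definition locally_lipschitz_on ::
    "('a::metric_space) set \<Rightarrow> ('a \<Rightarrow> 'b::metric_space) \<Rightarrow> bool" where
  "locally_lipschitz_on U F \<longleftrightarrow> (\<forall>z\<in>U. \<exists>r>0. \<exists>C. C-lipschitz_on (cball z r \<inter> U) F)"

definition q_superlinear :: "(nat \<Rightarrow> 'a::real_normed_vector) \<Rightarrow> 'a \<Rightarrow> bool" where
  "q_superlinear z zs \<longleftrightarrow> z \<longlonglongrightarrow> zs
     \<and> (\<lambda>k. norm (z (Suc k) - zs) / norm (z k - zs)) \<longlonglongrightarrow> 0"

text \<open>A point \<open>z = (x, t)\<close> with \<open>x\<close> in \<open>real^'n\<close> is a vector indexed by \<open>'n option\<close>:
  the indices \<open>Some j\<close> carry \<open>x\<close>, the index \<open>None\<close> carries \<open>t\<close>. Its norm is the Euclidean norm of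
  the pair, and \<open>(n+1) \<times> (n+1)\<close> matrices are ordinary matrices.\<close>

definition xpart :: "real^('n option) \<Rightarrow> real^'n" where
  "xpart z = (\<chi> j. z $ Some j)"

definition tpart :: "real^('n::finite option) \<Rightarrow> real" where
  "tpart z = z $ None"

definition phi :: "real \<Rightarrow> real \<Rightarrow> real" where
  "phi \<tau> r = (r + sqrt (r\<^sup>2 + \<tau>\<^sup>2)) / 2"

definition Phi :: "('m::finite \<Rightarrow> real^'n \<Rightarrow> real) \<Rightarrow> real \<Rightarrow> real^('n option) \<Rightarrow> real" where
  "Phi f \<tau> z = tpart z + (\<Sum>i\<in>UNIV. phi \<tau> (f i (xpart z) - tpart z))"

definition qvec :: "(real^'n \<Rightarrow> real) \<Rightarrow> real^'n \<Rightarrow> real^('n option)" where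
  "qvec F x = (\<chi> j. case j of Some l \<Rightarrow> grad F x $ l | None \<Rightarrow> -1)"

definition omega :: "(real^'n \<Rightarrow> real) \<Rightarrow> real \<Rightarrow> real^('n option) \<Rightarrow> real" where
  "omega F \<tau> z = sqrt ((F (xpart z) - tpart z)\<^sup>2 + \<tau>\<^sup>2)"

definition Jmat :: "('m::finite \<Rightarrow> real^'n \<Rightarrow> real) \<Rightarrow> real^('n option) \<Rightarrow> real^('n option)^'m" where
  "Jmat f z = (\<chi> i. qvec (f i) (xpart z))"

definition Dhyp :: "('m::finite \<Rightarrow> real^'n \<Rightarrow> real) \<Rightarrow> real \<Rightarrow> real^('n option) \<Rightarrow> real^'m^'m" where
  "Dhyp f \<tau> z = (\<chi> i j. if i = j then inverse (omega (f i) \<tau> z) else 0)"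

definition Pi_x :: "real^('n::finite option)^('n option)" where
  "Pi_x = (\<chi> i j. if i = j \<and> i \<noteq> None then 1 else 0)"

definition precond :: "('m::finite \<Rightarrow> real^'n \<Rightarrow> real) \<Rightarrow> ('m \<Rightarrow> real) \<Rightarrow> real \<Rightarrow> real
    \<Rightarrow> real^('n option) \<Rightarrow> real^('n option)^('n option)" where
  "precond f L \<delta> \<tau> z = \<delta> *\<^sub>R mat 1 + (\<Sum>i\<in>UNIV. L i) *\<^sub>R Pi_x
     + (1/2) *\<^sub>R (transpose (Jmat f z) ** Dhyp f \<tau> z ** Jmat f z)"

datatype bfgs_mode = ModeN | ModeE | ModeH

definition outer :: "real^'d \<Rightarrow> real^'d \<Rightarrow> real^'d^'d" where
  "outer u v = (\<chi> i j. u $ i * v $ j)"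

definition curv_threshold :: "real \<Rightarrow> real \<Rightarrow> real^'d \<Rightarrow> real^'d \<Rightarrow> real" where
  "curv_threshold mcur Mcur s y = max (mcur * (norm s)\<^sup>2) ((norm y)\<^sup>2 / Mcur)"

definition direct_test :: "real \<Rightarrow> real \<Rightarrow> real^'d \<Rightarrow> real^'d \<Rightarrow> bool" where
  "direct_test mcur Mcur s y \<longleftrightarrow> s \<bullet> y > curv_threshold mcur Mcur s y"

text \<open>The vector used in the update in place of \<open>y\<close>; \<open>None\<close> means that the pair is skipped.
  \<open>B\<close> is the current Hessian approximation.\<close>

definition used_y :: "bfgs_mode \<Rightarrow> real \<Rightarrow> real \<Rightarrow> real^'d^'d \<Rightarrow> real^'d \<Rightarrow> real^'d
    \<Rightarrow> (real^'d) option" where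
  "used_y md mcur Mcur B s y =
    (let c = s \<bullet> y; \<eta> = curv_threshold mcur Mcur s y in
     if direct_test mcur Mcur s y then Some y
     else (case md of
         ModeN \<Rightarrow> if c < - \<eta> then Some (- y) else None
       | ModeE \<Rightarrow> if c < - \<eta> then Some (y - (2 * c / (s \<bullet> s)) *\<^sub>R s) else None
       | ModeH \<Rightarrow>
           (let yt = y - (2 * c / (s \<bullet> (B *v s))) *\<^sub>R (B *v s) in
            if c < - (mcur * (norm s)\<^sup>2) \<and> (norm yt)\<^sup>2 < Mcur * \<bar>c\<bar> then Some yt else None)))"

definition bfgs_update :: "real^'d^'d \<Rightarrow> real^'d \<Rightarrow> real^'d \<Rightarrow> real^'d^'d" where
  "bfgs_update H s y =
    (let \<rho> = inverse (s \<bullet> y) in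
     (mat 1 - \<rho> *\<^sub>R outer s y) ** H ** (mat 1 - \<rho> *\<^sub>R outer y s) + \<rho> *\<^sub>R outer s s)"

definition search_dir :: "(real^'d \<Rightarrow> real) \<Rightarrow> real^'d^'d \<Rightarrow> real^'d \<Rightarrow> real^'d" where
  "search_dir F H z = - (H *v grad F z)"

definition armijo :: "(real^'d \<Rightarrow> real) \<Rightarrow> real \<Rightarrow> real^'d \<Rightarrow> real^'d \<Rightarrow> real \<Rightarrow> bool" where
  "armijo F \<alpha> z d t \<longleftrightarrow> F (z + t *\<^sub>R d) \<le> F z + \<alpha> * t * (grad F z \<bullet> d)"

definition sdiff :: "(nat \<Rightarrow> real^'d) \<Rightarrow> nat \<Rightarrow> real^'d" where
  "sdiff z k = z (Suc k) - z k"

definition ydiff :: "(real^'d \<Rightarrow> real) \<Rightarrow> (nat \<Rightarrow> real^'d) \<Rightarrow> nat \<Rightarrow> real^'d" where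
  "ydiff F z k = grad F (z (Suc k)) - grad F (z k)"

text \<open>An infinite run on the objective \<open>F\<close> from \<open>z0\<close>, \<open>H0\<close>. The number \<open>j k\<close> counts the
  backtracking reductions at iteration \<open>k\<close>, so the accepted step length is \<open>\<beta> ^ j k\<close>.\<close>

definition bfgs_run :: "bfgs_mode \<Rightarrow> (real^'d \<Rightarrow> real) \<Rightarrow> real \<Rightarrow> real \<Rightarrow> real \<Rightarrow> real
    \<Rightarrow> real^'d \<Rightarrow> real^'d^'d
    \<Rightarrow> (nat \<Rightarrow> real^'d) \<Rightarrow> (nat \<Rightarrow> real^'d^'d) \<Rightarrow> (nat \<Rightarrow> nat) \<Rightarrow> bool" where
  "bfgs_run md F \<alpha> \<beta> mcur Mcur z0 H0 z H j \<longleftrightarrow>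
     z 0 = z0 \<and> H 0 = H0 \<and>
     (\<forall>k. grad F (z k) \<noteq> 0
        \<and> armijo F \<alpha> (z k) (search_dir F (H k) (z k)) (\<beta> ^ j k)
        \<and> (\<forall>i<j k. \<not> armijo F \<alpha> (z k) (search_dir F (H k) (z k)) (\<beta> ^ i))
        \<and> z (Suc k) = z k + \<beta> ^ j k *\<^sub>R search_dir F (H k) (z k)
        \<and> H (Suc k) =
            (case used_y md mcur Mcur (matrix_inv (H k)) (sdiff z k) (ydiff F z k) of
               None \<Rightarrow> H k
             | Some yt \<Rightarrow> bfgs_update (H k) (sdiff z k) yt))"

text \<open>The union of the segments from \<open>z k\<close> to all points tested by the backtracking at
  iteration \<open>k\<close>, the accepted one included.\<close>

definition trial_segments :: "(real^'d \<Rightarrow> real) \<Rightarrow> real \<Rightarrow> (nat \<Rightarrow> real^'d)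
    \<Rightarrow> (nat \<Rightarrow> real^'d^'d) \<Rightarrow> (nat \<Rightarrow> nat) \<Rightarrow> nat \<Rightarrow> (real^'d) set" where
  "trial_segments F \<beta> z H j k =
     (\<Union>i\<le>j k. closed_segment (z k) (z k + \<beta> ^ i *\<^sub>R search_dir F (H k) (z k)))"

definition correction_inactive :: "bfgs_mode \<Rightarrow> (real^'d \<Rightarrow> real) \<Rightarrow> real \<Rightarrow> real
    \<Rightarrow> (nat \<Rightarrow> real^'d) \<Rightarrow> (nat \<Rightarrow> real^'d^'d) \<Rightarrow> nat \<Rightarrow> bool" where
  "correction_inactive md F mcur Mcur z H k \<longleftrightarrow>
     used_y md mcur Mcur (matrix_inv (H k)) (sdiff z k) (ydiff F z k) = Some (ydiff F z k)"

end

theory Submission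
  imports Defs
begin

text \<open>
  On \<open>U\<close> the objective is strongly convex with a Lipschitz gradient, so every pair inside \<open>U\<close> passes the
  direct test and the method becomes plain BFGS. The trace of \<open>B\<^sub>k = H\<^sub>k\<^sup>-\<^sup>1\<close> drops by
  \<open>\<bar>B s\<bar>\<^sup>2 / s\<^sup>T B s\<close> and rises by a bounded amount in each step. Hence these quotients are bounded on
  average, and, with unit steps, the Armijo condition gives R-linear convergence, so the errors are
  summable. The potential \<open>tr (G\<^sup>-\<^sup>1 B\<^sub>k) - ln \<bar>det B\<^sub>k\<bar>\<close> with \<open>G\<close> the Hessian at the limit then forces
  \<open>\<bar>(B\<^sub>k - G) s\<^sub>k\<bar> / \<bar>s\<^sub>k\<bar> \<rightarrow> 0\<close> (Dennis-More), which for unit steps is superlinear convergence.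
\<close>

section \<open>Positive semidefinite matrices\<close>

text \<open>Nothing bounds the condition number of \<open>H k\<close> beforehand, yet the
  Dennis-More argument needs summable errors, hence a rate, before it can start. The trace breaks
  this circle. Under a unit step B s is minus the gradient g, so the trace quotient is |g|^2 / (s
  \<bullet> B s), and \<alpha> (s \<bullet> B s) is the decrease that the Armijo condition
  guarantees: an average bound on the quotient becomes an average bound on the relative decrease.
  Convergence is thus known before the Lipschitz condition on the Hessian is used; that condition
  holds only near \<open>zs\<close> and is applied to a further tail of the sequence. In the
  potential, tr (G^-1 B) stands for the trace of G^(-1/2) B G^(-1/2), so no matrix square root is
  formed, and leaving out the constant ln det G changes no difference. Semidefinite matrices are
  split into outer products by elimination instead of eigenvectors. Determinants appear in absolute
  value, so that it is enough to know that they do not vanish.\<close>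

lemma outer_mult_vec: "outer u v *v x = (v \<bullet> x) *\<^sub>R u"
  by (simp add: vec_eq_iff outer_def matrix_vector_mult_def inner_vec_def sum_distrib_right
      sum_distrib_left mult.commute mult.left_commute)

lemma transpose_outer: "transpose (outer u v) = outer v u"
  by (simp add: vec_eq_iff outer_def transpose_def mult.commute)

lemma trace_scaleR: "trace (c *\<^sub>R A) = c * trace A" for A :: "real^'d^'d"
  by (simp add: trace_def sum_distrib_left)

lemma trace_outer: "trace (outer u v) = u \<bullet> v"
  by (simp add: trace_def outer_def inner_vec_def)

lemma matrix_mult_outer: "A ** outer u v = outer (A *v u) v" for A :: "real^'d^'d"
  by (simp add: vec_eq_iff outer_def matrix_matrix_mult_def matrix_vector_mult_def
      sum_distrib_right mult.assoc)

lemma outer_mult_matrix: "outer u v ** A = outer u (transpose A *v v)" for A :: "real^'d^'d"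
  by (simp add: vec_eq_iff outer_def matrix_matrix_mult_def matrix_vector_mult_def transpose_def
      sum_distrib_left mult.assoc mult.left_commute mult.commute)

lemma matrix_diff_mult: "(A - B) ** C = A ** C - B ** C" for A B C :: "real^'d^'d"
  by (simp add: vec_eq_iff matrix_matrix_mult_def left_diff_distrib sum_subtractf)

lemma matrix_mult_diff: "C ** (A - B) = C ** A - C ** B" for A B C :: "real^'d^'d"
  by (simp add: vec_eq_iff matrix_matrix_mult_def right_diff_distrib sum_subtractf)

lemma matrix_mult_sum_right: "A ** (\<Sum>i\<in>I. B i) = (\<Sum>i\<in>I. A ** B i)" for A :: "real^'d^'d"
proof (induction I rule: infinite_finite_induct)
  case (insert i I)
  then show ?case by (simp add: matrix_add_ldistrib)
qed (simp_all add: vec_eq_iff matrix_matrix_mult_def)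

lemma trace_sum: "trace (\<Sum>i\<in>I. B i) = (\<Sum>i\<in>I. trace (B i))" for B :: "_ \<Rightarrow> real^'d^'d"
  by (induction I rule: infinite_finite_induct) (simp_all add: trace_def sum.distrib)

lemma transpose_diff: "transpose (A - B) = transpose A - transpose B" for A :: "real^'m^'n"
  by (simp add: vec_eq_iff transpose_def)

lemma transpose_add: "transpose (A + B) = transpose A + transpose B" for A :: "real^'m^'n"
  by (simp add: vec_eq_iff transpose_def)

lemma transpose_scaleR: "transpose (c *\<^sub>R A) = c *\<^sub>R transpose A" for A :: "real^'m^'n"
  by (simp add: vec_eq_iff transpose_def)

lemma inner_matrix_vec_transpose: "u \<bullet> (A *v v) = (transpose A *v u) \<bullet> v"
  for A :: "real^'n^'m"
  by (metis dot_lmul_matrix transpose_matrix_vector)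

lemma inner_sym_matrix:
  fixes A :: "real^'d^'d"
  assumes "transpose A = A"
  shows "u \<bullet> (A *v v) = v \<bullet> (A *v u)"
  using assms inner_matrix_vec_transpose[of u A v] by (simp add: inner_commute)

text \<open>Here \<open>norm A\<close> is the Frobenius norm, so Cauchy-Schwarz in each row
  suffices. This turns the Lipschitz bound on the Hessian, stated in that norm, into an operator
  bound.\<close>

lemma norm_matrix_vec_le: "norm (A *v x) \<le> norm A * norm x" for A :: "real^'n^'m"
proof -
  have "(norm (A *v x))\<^sup>2 = (\<Sum>i\<in>UNIV. (A $ i \<bullet> x)\<^sup>2)"
    by (simp add: norm_vec_def L2_set_def sum_nonneg matrix_vector_mul_component)
  also have "\<dots> \<le> (\<Sum>i\<in>UNIV. (norm (A $ i))\<^sup>2 * (norm x)\<^sup>2)"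
    by (intro sum_mono) (metis Cauchy_Schwarz_ineq2 abs_le_square_iff abs_mult abs_norm_cancel power_mult_distrib)
  also have "\<dots> = (norm A * norm x)\<^sup>2"
    unfolding power_mult_distrib sum_distrib_right[symmetric]
    by (simp add: norm_vec_def[of A] L2_set_def sum_nonneg)
  finally show ?thesis
    by (rule power2_le_imp_le) simp
qed

text \<open>The form at u + t v is a nonnegative quadratic in t, and its value at the minimizer -b/c
  gives the inequality. If c = 0 it is affine in t, and nonnegativity forces b = 0.\<close>

lemma psd_Cauchy_Schwarz:
  assumes "psd A"
  shows "(u \<bullet> (A *v v))\<^sup>2 \<le> (u \<bullet> (A *v u)) * (v \<bullet> (A *v v))"
proof -
  define a b c where "a = u \<bullet> (A *v u)" and "b = u \<bullet> (A *v v)" and "c = v \<bullet> (A *v v)"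
  have sym: "v \<bullet> (A *v u) = b"
    using assms inner_sym_matrix unfolding psd_def b_def by blast
  have q: "0 \<le> a + 2 * t * b + t\<^sup>2 * c" for t
  proof -
    have "0 \<le> (u + t *\<^sub>R v) \<bullet> (A *v (u + t *\<^sub>R v))"
      using assms by (simp add: psd_def)
    also have "\<dots> = a + 2 * t * b + t\<^sup>2 * c"
      using sym by (simp add: a_def b_def c_def matrix_vector_right_distrib matrix_vector_mult_scaleR
          inner_add_left inner_add_right algebra_simps power2_eq_square)
    finally show ?thesis .
  qed
  have c0: "0 \<le> c"
    using assms by (simp add: psd_def c_def)
  show ?thesis
  proof (cases "c = 0")
    case True
    have "b = 0"
    proof (rule ccontr)
      assume "b \<noteq> 0"
      \<comment> \<open>At this t the affine function a + 2 t b takes the value -1.\<close>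
      then show False
        using q[of "- (a + 1) / (2 * b)"] True by (simp add: field_simps)
    qed
    then show ?thesis
      using True by (simp add: b_def c_def)
  next
    case False
    have "0 \<le> a + 2 * (- b / c) * b + (- b / c)\<^sup>2 * c"
      by (rule q)
    also have "\<dots> = a - b\<^sup>2 / c"
      using False by (simp add: field_simps power2_eq_square)
    finally have "b\<^sup>2 \<le> a * c"
      using False c0 by (simp add: field_simps)
    then show ?thesis
      by (simp add: a_def b_def c_def)
  qed
qed

lemma inner_axis_matrix: "axis i 1 \<bullet> (A *v axis j 1) = A $ i $ j" for A :: "real^'d^'d"
  by (simp add: matrix_vector_mult_basis column_def inner_axis_axis inner_axis')

lemma psd_diag_nonneg: "psd A \<Longrightarrow> 0 \<le> A $ i $ i"
  by (metis inner_axis_matrix psd_def)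

lemma psd_entry_le_trace:
  assumes "psd A"
  shows "\<bar>A $ i $ j\<bar> \<le> trace A"
proof -
  have d: "A $ k $ k \<le> trace A" for k
    unfolding trace_def using psd_diag_nonneg[OF assms] by (intro member_le_sum) auto
  have "(A $ i $ j)\<^sup>2 \<le> A $ i $ i * A $ j $ j"
    using psd_Cauchy_Schwarz[OF assms, of "axis i 1" "axis j 1"] by (simp add: inner_axis_matrix)
  also have "\<dots> \<le> (trace A)\<^sup>2"
    unfolding power2_eq_square
    using d psd_diag_nonneg[OF assms] by (intro mult_mono) (auto intro: order_trans)
  finally show ?thesis
    using psd_diag_nonneg[OF assms, of i] d[of i] by (metis abs_le_square_iff abs_of_nonneg order_trans)
qed

text \<open>Leibniz expansion with every entry bounded by the trace. The factorial costs only an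
  additive constant once logarithms are taken; the degree in the trace is what matters.\<close>

lemma psd_abs_det_le:
  fixes A :: "real^'d^'d"
  assumes "psd A"
  shows "\<bar>det A\<bar> \<le> fact CARD('d) * trace A ^ CARD('d)"
proof -
  have "\<bar>det A\<bar> \<le> (\<Sum>p\<in>{p. p permutes (UNIV :: 'd set)}. \<bar>of_int (sign p) * (\<Prod>i\<in>UNIV. A $ i $ p i)\<bar>)"
    unfolding det_def by (rule sum_abs)
  also have "\<dots> \<le> (\<Sum>p\<in>{p. p permutes (UNIV :: 'd set)}. trace A ^ CARD('d))"
  proof (rule sum_mono)
    fix p :: "'d \<Rightarrow> 'd"
    have "\<bar>of_int (sign p) * (\<Prod>i\<in>UNIV. A $ i $ p i)\<bar> = (\<Prod>i\<in>UNIV. \<bar>A $ i $ p i\<bar>)"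
      by (simp add: abs_mult sign_def abs_prod)
    also have "\<dots> \<le> (\<Prod>i\<in>(UNIV::'d set). trace A)"
      by (rule prod_mono) (auto intro: psd_entry_le_trace[OF assms])
    finally show "\<bar>of_int (sign p) * (\<Prod>i\<in>UNIV. A $ i $ p i)\<bar> \<le> trace A ^ CARD('d)"
      by simp
  qed
  also have "\<dots> = fact CARD('d) * trace A ^ CARD('d)"
    by (simp add: card_permutations)
  finally show ?thesis .
qed

text \<open>Cholesky elimination, one index of the support at a time: subtracting
  \<open>outer v v\<close> clears row and column k, and Cauchy-Schwarz against the unit vector keeps
  the remainder semidefinite.\<close>

lemma psd_sum_outer_supported:
  fixes A :: "real^'d^'d"
  assumes "finite I" "psd A" "\<And>i j. i \<notin> I \<Longrightarrow> A $ i $ j = 0"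
  shows "\<exists>V. A = (\<Sum>i\<in>I. outer (V i) (V i))"
  using assms
proof (induction I arbitrary: A rule: finite_induct)
  case empty
  then show ?case by (simp add: vec_eq_iff)
next
  case (insert k I)
  define e where "e = (axis k 1 :: real^'d)"
  define a where "a = A $ k $ k"
  \<comment> \<open>With a zero pivot nothing has to be subtracted: Cauchy-Schwarz then shows that
    column k vanishes already.\<close>
  define v where "v = (if a = 0 then 0 else (1 / sqrt a) *\<^sub>R (A *v e))"
  have a0: "0 \<le> a"
    unfolding a_def by (rule psd_diag_nonneg[OF insert.prems(1)])
  have sym: "transpose A = A" and symc: "\<And>i j. A $ i $ j = A $ j $ i"
    using insert.prems(1) by (auto simp: psd_def vec_eq_iff transpose_def)
  have ea: "e \<bullet> (A *v e) = a"
    by (simp add: e_def a_def inner_axis_matrix)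
  have cs: "(x \<bullet> (A *v e))\<^sup>2 \<le> (x \<bullet> (A *v x)) * a" for x
    using psd_Cauchy_Schwarz[OF insert.prems(1), of x e] by (simp only: ea)
  have col: "(A *v e) $ i = A $ i $ k" for i
    by (simp add: e_def matrix_vector_mult_basis column_def)
  have vv: "outer v v $ i $ j = A $ i $ k * A $ j $ k / a" if "a \<noteq> 0" for i j
    using that a0 by (simp add: v_def outer_def col field_simps)
  have "psd (A - outer v v)"
    unfolding psd_def
  proof (intro conjI allI)
    show "transpose (A - outer v v) = A - outer v v"
      by (simp add: transpose_diff transpose_outer sym)
    fix x
    have "(v \<bullet> x)\<^sup>2 \<le> x \<bullet> (A *v x)"
    proof (cases "a = 0")
      case True
      then show ?thesis using insert.prems(1) by (simp add: v_def psd_def)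
    next
      case False
      then have "(v \<bullet> x)\<^sup>2 = (x \<bullet> (A *v e))\<^sup>2 / a"
        using a0 by (simp add: v_def power_mult_distrib power_divide inner_commute)
      also have "\<dots> \<le> x \<bullet> (A *v x)"
        using cs[of x] False a0 by (simp add: field_simps)
      finally show ?thesis .
    qed
    then show "0 \<le> x \<bullet> ((A - outer v v) *v x)"
      by (simp add: matrix_vector_mult_diff_rdistrib outer_mult_vec inner_diff_right
          power2_eq_square inner_commute)
  qed
  moreover have "(A - outer v v) $ i $ j = 0" if "i \<notin> I" for i j
  proof (cases "i = k")
    case True
    show ?thesis
    proof (cases "a = 0")
      case True
      then have "A $ j $ k = 0"
        using cs[of "axis j 1"] by (simp add: e_def inner_axis_matrix)
      with True \<open>i = k\<close> show ?thesis
        by (simp add: symc[of k j] v_def outer_def)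
    next
      case False
      then show ?thesis
        using vv[of k j] \<open>i = k\<close> symc[of k j] by (simp add: a_def)
    qed
  next
    case False
    then have "A $ i $ l = 0" for l
      using that insert.prems(2) by auto
    then show ?thesis
      using vv[of i j] by (cases "a = 0") (auto simp: v_def outer_def)
  qed
  ultimately obtain V where "A - outer v v = (\<Sum>i\<in>I. outer (V i) (V i))"
    using insert.IH by meson
  then have "A = outer v v + (\<Sum>i\<in>I. outer (V i) (V i))"
    by (simp add: algebra_simps)
  also have "\<dots> = (\<Sum>i\<in>insert k I. outer ((V(k := v)) i) ((V(k := v)) i))"
    using insert.hyps by (auto intro!: sum.cong)
  finally show ?case
    by blast
qed

text \<open>Once A is a sum of outer products of vectors V i, both traces become sums over i, of |V
  i|^2 and of V i \<bullet> W (V i), and the hypothesis applies termwise.\<close>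

lemma psd_trace_mult_ge:
  fixes A W :: "real^'d^'d"
  assumes "psd A" "\<And>u. w * (norm u)\<^sup>2 \<le> u \<bullet> (W *v u)"
  shows "w * trace A \<le> trace (W ** A)"
proof -
  have "\<exists>V. A = (\<Sum>i\<in>(UNIV :: 'd set). outer (V i) (V i))"
    by (rule psd_sum_outer_supported) (use assms(1) in auto)
  then obtain V where V: "A = (\<Sum>i\<in>(UNIV :: 'd set). outer (V i) (V i))" ..
  have "w * trace A = (\<Sum>i\<in>UNIV. w * (norm (V i))\<^sup>2)"
    by (simp add: V trace_sum trace_outer sum_distrib_left power2_norm_eq_inner)
  also have "\<dots> \<le> (\<Sum>i\<in>UNIV. V i \<bullet> (W *v V i))"
    by (intro sum_mono assms(2))
  also have "\<dots> = trace (W ** A)"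
    by (simp add: V matrix_mult_sum_right trace_sum matrix_mult_outer trace_outer inner_commute)
  finally show ?thesis .
qed

section \<open>Determinants of rank-one perturbations of the identity\<close>

lemma det_add_outer_axis: "det (mat 1 + outer (axis k 1) w) = 1 + w $ k" for w :: "real^'d"
proof -
  define x where "x = axis k 1 + w"
  have "mat 1 + outer (axis k 1) w =
      (\<chi> i. if i = k then (\<Sum>i\<in>UNIV. x $ i *s row i (mat 1)) else row i (mat 1))"
    unfolding vec_eq_iff
    by (auto simp: outer_def x_def axis_def mat_def row_def sum.delta if_distrib cong: if_cong)
  then have "det (mat 1 + outer (axis k 1) w) = x $ k * det (mat 1 :: real^'d^'d)"
    using cramer_lemma_transpose[of k x "mat 1"] by simp
  then show ?thesis
    by (simp add: x_def axis_def)
qed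

text \<open>The matrix determinant lemma, by similarity: P sends e to u, so conjugation by P turns
  \<open>outer u v\<close> into \<open>outer e w\<close> with w $ k = u \<bullet> v, the case
  treated before. The choice of k makes det P = u $ k nonzero.\<close>

lemma det_sub_outer: "det (mat 1 - outer u v) = 1 - u \<bullet> v" for u v :: "real^'d"
proof (cases "u = 0")
  case True
  then have "outer u v = 0" by (simp add: outer_def vec_eq_iff)
  then show ?thesis using True by simp
next
  case False
  then obtain k where k: "u $ k \<noteq> 0" by (auto simp: vec_eq_iff)
  define e where "e = (axis k 1 :: real^'d)"
  define P where "P = mat 1 + outer (u - e) e"
  have "det P = det (transpose P)" by simp
  also have "transpose P = mat 1 + outer e (u - e)"
    by (simp add: P_def transpose_add transpose_outer transpose_mat)
  also have "det \<dots> = u $ k"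
    unfolding e_def by (subst det_add_outer_axis) simp
  finally have detP: "det P = u $ k" .
  have Pe: "P *v e = u"
    by (simp add: P_def e_def matrix_vector_mult_add_rdistrib outer_mult_vec inner_axis_axis)
  define w where "w = transpose P *v v"
  have wk: "w $ k = u \<bullet> v"
  proof -
    have "w $ k = w \<bullet> e" by (simp add: e_def inner_axis)
    also have "\<dots> = v \<bullet> (P *v e)" by (simp add: w_def inner_matrix_vec_transpose)
    finally show ?thesis by (simp add: Pe inner_commute)
  qed
  have "(mat 1 - outer u v) ** P = P - outer u w"
    by (simp add: matrix_diff_mult outer_mult_matrix w_def)
  also have "\<dots> = P ** (mat 1 + outer e (- w))"
    by (simp add: matrix_add_ldistrib matrix_mult_outer Pe) (simp add: outer_def vec_eq_iff)
  finally have "det (mat 1 - outer u v) * det P = det P * (1 - u \<bullet> v)"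
    by (metis det_mul det_add_outer_axis e_def wk vector_uminus_component uminus_add_conv_diff diff_conv_add_uminus)
  then show ?thesis
    using k detP by simp
qed

section \<open>The BFGS update\<close>

definition pos_def :: "real^'d^'d \<Rightarrow> bool" where
  "pos_def A \<longleftrightarrow> transpose A = A \<and> (\<forall>v. v \<noteq> 0 \<longrightarrow> 0 < v \<bullet> (A *v v))"

lemma pos_def_psd: "pos_def A \<Longrightarrow> psd A"
  unfolding pos_def_def psd_def by (metis inner_zero_left less_imp_le order_refl)

lemma pos_def_kernel: "pos_def A \<Longrightarrow> A *v v = 0 \<Longrightarrow> v = 0"
  unfolding pos_def_def by (metis inner_zero_right less_irrefl)

lemma pos_def_invertible:
  assumes "pos_def A"
  shows "invertible A"
  using pos_def_kernel[OF assms] matrix_left_invertible_ker[of A] invertible_left_inverse by blast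

lemma pos_def_matrix_inv_mult:
  fixes A :: "real^'d^'d"
  assumes "pos_def A"
  shows "A ** matrix_inv A = mat 1" "matrix_inv A ** A = mat 1"
    "A *v (matrix_inv A *v v) = v" "matrix_inv A *v (A *v v) = v"
proof -
  show 1: "A ** matrix_inv A = mat 1" "matrix_inv A ** A = mat 1"
    using someI_ex[OF pos_def_invertible[OF assms, unfolded invertible_def]]
    unfolding matrix_inv_def by auto
  show "A *v (matrix_inv A *v v) = v" "matrix_inv A *v (A *v v) = v"
    by (simp_all add: matrix_vector_mul_assoc 1)
qed

lemma matrix_inv_eqI:
  fixes A B :: "real^'d^'d"
  assumes "pos_def A" "A ** B = mat 1"
  shows "matrix_inv A = B"
  by (metis assms matrix_mul_assoc matrix_mul_lid matrix_mul_rid pos_def_matrix_inv_mult(2))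

lemma pos_def_matrix_inv:
  fixes A :: "real^'d^'d"
  assumes "pos_def A"
  shows "pos_def (matrix_inv A)"
  unfolding pos_def_def
proof (intro conjI allI impI)
  have sym: "transpose A = A" using assms by (simp add: pos_def_def)
  have "A ** transpose (matrix_inv A) = transpose (matrix_inv A ** A)"
    by (simp add: matrix_transpose_mul sym)
  also have "\<dots> = mat 1"
    by (simp add: pos_def_matrix_inv_mult[OF assms])
  finally show "transpose (matrix_inv A) = matrix_inv A"
    using matrix_inv_eqI[OF assms] by metis
  fix v :: "real^'d"
  assume "v \<noteq> 0"
  then have "matrix_inv A *v v \<noteq> 0"
    by (metis assms matrix_vector_mult_0_right pos_def_matrix_inv_mult(3))
  then have "0 < (matrix_inv A *v v) \<bullet> (A *v (matrix_inv A *v v))"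
    using assms unfolding pos_def_def by blast
  then show "0 < v \<bullet> (matrix_inv A *v v)"
    by (simp add: pos_def_matrix_inv_mult[OF assms] inner_commute)
qed

lemma pos_def_det_nonzero:
  assumes "pos_def A"
  shows "det A \<noteq> 0"
  using pos_def_invertible[OF assms] invertible_det_nz by blast

lemma pos_def_scaleR: "pos_def A \<Longrightarrow> 0 < c \<Longrightarrow> pos_def (c *\<^sub>R A)"
  by (simp add: pos_def_def transpose_scaleR scaleR_matrix_vector_assoc[symmetric])

lemma pos_def_congruence:
  fixes A C :: "real^'d^'d"
  assumes "pos_def A" "det C \<noteq> 0"
  shows "pos_def (C ** A ** transpose C)"
  unfolding pos_def_def
proof (intro conjI allI impI)
  show "transpose (C ** A ** transpose C) = C ** A ** transpose C"
    using assms(1) by (simp add: matrix_transpose_mul pos_def_def matrix_mul_assoc)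
  fix v :: "real^'d"
  assume "v \<noteq> 0"
  have "invertible (transpose C)"
    using assms(2) by (simp add: invertible_det_nz)
  then have "transpose C *v v \<noteq> 0"
    by (metis \<open>v \<noteq> 0\<close> invertible_left_inverse matrix_left_invertible_ker)
  then have "0 < (transpose C *v v) \<bullet> (A *v (transpose C *v v))"
    using assms(1) unfolding pos_def_def by blast
  also have "\<dots> = v \<bullet> ((C ** A ** transpose C) *v v)"
    by (simp only: inner_matrix_vec_transpose[of v C] matrix_vector_mul_assoc[symmetric])
  finally show "0 < v \<bullet> ((C ** A ** transpose C) *v v)" .
qed

text \<open>Multiplied out, the update is H plus rank-one terms, so identities about it can be
  checked on vectors without matrix products.\<close>

lemma bfgs_update_expand:
  fixes H :: "real^'d^'d"
  assumes "transpose H = H" "\<rho> = inverse (s \<bullet> y)"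
  shows "bfgs_update H s y = H - \<rho> *\<^sub>R outer s (H *v y) - \<rho> *\<^sub>R outer (H *v y) s
    + (\<rho>\<^sup>2 * (y \<bullet> (H *v y)) + \<rho>) *\<^sub>R outer s s"
proof -
  have "(bfgs_update H s y) *v x = (H - \<rho> *\<^sub>R outer s (H *v y) - \<rho> *\<^sub>R outer (H *v y) s
    + (\<rho>\<^sup>2 * (y \<bullet> (H *v y)) + \<rho>) *\<^sub>R outer s s) *v x" for x
    unfolding bfgs_update_def Let_def assms(2)[symmetric]
    using inner_sym_matrix[OF assms(1), of y x]
    by (simp add: matrix_vector_mult_add_rdistrib matrix_vector_mult_diff_rdistrib
        matrix_vector_mul_assoc[symmetric] scaleR_matrix_vector_assoc[symmetric] outer_mult_vec
        matrix_vector_mult_diff_distrib matrix_vector_mult_scaleR inner_diff_right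
        inner_commute algebra_simps power2_eq_square)
  then show ?thesis
    by (simp add: matrix_eq)
qed

text \<open>The update is a congruence \<open>C ** H ** transpose C\<close> with \<open>C\<close> a rank-one perturbation of the
  identity, which yields positive definiteness and the determinant at once.\<close>

lemma bfgs_update_congruence:
  fixes H :: "real^'d^'d"
  assumes H: "pos_def H" and sy: "0 < s \<bullet> y"
  obtains C where "bfgs_update H s y = C ** H ** transpose C"
    "(det C)\<^sup>2 = (s \<bullet> (matrix_inv H *v s)) / (s \<bullet> y)"
proof -
  define B where "B = matrix_inv H"
  define \<rho> where "\<rho> = inverse (s \<bullet> y)"
  define b where "b = s \<bullet> (B *v s)"
  have "s \<noteq> 0" using sy by auto
  then have b: "0 < b"
    using pos_def_matrix_inv[OF H] by (simp add: b_def B_def pos_def_def)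
  have \<rho>: "0 < \<rho>" "\<rho> * (s \<bullet> y) = 1" using sy by (auto simp: \<rho>_def)
  \<comment> \<open>The factor I - \<rho> s y^T of the definition is singular and leaves the summand
    \<rho> s s^T outside. Adding c B s to \<rho> y absorbs that summand: the terms linear in c
    cancel and the quadratic one contributes c^2 b, which must equal \<rho>.\<close>
  define c where "c = sqrt (\<rho> / b)"
  have c2: "c\<^sup>2 * b = \<rho>" using \<rho> b by (simp add: c_def)
  define w where "w = \<rho> *\<^sub>R y + c *\<^sub>R (B *v s)"
  have sym: "transpose H = H" using H by (simp add: pos_def_def)
  have Hw: "H *v w = \<rho> *\<^sub>R (H *v y) + c *\<^sub>R s"
    by (simp add: w_def matrix_vector_right_distrib matrix_vector_mult_scaleR
        B_def pos_def_matrix_inv_mult[OF H])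
  have "(B *v s) \<bullet> (H *v y) = y \<bullet> s"
    using inner_sym_matrix[OF sym, of "B *v s" y] by (simp add: B_def pos_def_matrix_inv_mult[OF H])
  then have wHw: "w \<bullet> (H *v w) = \<rho>\<^sup>2 * (y \<bullet> (H *v y)) + (c + c) + \<rho>"
    unfolding Hw using \<rho>(2) c2 b_def
    by (simp add: w_def inner_add_left inner_add_right inner_commute[of "B *v s"] inner_commute[of y s]
        algebra_simps power2_eq_square)
  define C where "C = mat 1 - outer s w"
  have "(C ** H ** transpose C) *v x = bfgs_update H s y *v x" for x
  proof -
    have "(C ** H ** transpose C) *v x = H *v x - (s \<bullet> x) *\<^sub>R (H *v w) - ((H *v w) \<bullet> x) *\<^sub>R s
        + ((w \<bullet> (H *v w)) * (s \<bullet> x)) *\<^sub>R s"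
      using inner_sym_matrix[OF sym, of w x]
      by (simp add: C_def transpose_diff transpose_outer matrix_vector_mul_assoc[symmetric]
        matrix_vector_mult_diff_rdistrib outer_mult_vec matrix_vector_mult_diff_distrib
        matrix_vector_mult_scaleR inner_diff_right inner_commute algebra_simps)
    also have "\<dots> = bfgs_update H s y *v x"
      unfolding bfgs_update_expand[OF sym \<rho>_def] wHw unfolding Hw
      by (simp add: matrix_vector_mult_add_rdistrib matrix_vector_mult_diff_rdistrib
        scaleR_matrix_vector_assoc[symmetric] outer_mult_vec inner_add_left vec_eq_iff) (simp add: algebra_simps)
    finally show ?thesis .
  qed
  then have 1: "bfgs_update H s y = C ** H ** transpose C"
    by (simp add: matrix_eq)
  have "det C = - c * b"
    unfolding C_def det_sub_outer w_def using \<rho>(2) by (simp add: inner_add_right b_def)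
  then have "(det C)\<^sup>2 = \<rho> * b"
    using c2 by (simp add: power2_eq_square algebra_simps)
  then have "(det C)\<^sup>2 = (s \<bullet> (matrix_inv H *v s)) / (s \<bullet> y)"
    by (simp add: \<rho>_def b_def B_def field_simps)
  with 1 show thesis by (rule that)
qed

lemma pos_def_bfgs_update:
  assumes "pos_def H" "0 < s \<bullet> y"
  shows "pos_def (bfgs_update H s y)"
proof -
  obtain C where C: "bfgs_update H s y = C ** H ** transpose C"
    "(det C)\<^sup>2 = (s \<bullet> (matrix_inv H *v s)) / (s \<bullet> y)"
    using bfgs_update_congruence[OF assms] .
  have "s \<noteq> 0" using assms(2) by auto
  then have "0 < (det C)\<^sup>2"
    unfolding C(2) using pos_def_matrix_inv[OF assms(1)] assms(2) by (simp add: pos_def_def)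
  then show ?thesis
    using pos_def_congruence[OF assms(1)] C(1) by auto
qed

text \<open>The classical rank-two formula for the direct BFGS update. A right inverse of a positive
  definite matrix is its inverse, so only one product is checked, on a vector x.\<close>

lemma bfgs_inverse:
  fixes H :: "real^'d^'d"
  assumes H: "pos_def H" and sy: "0 < s \<bullet> y" and B: "B = matrix_inv H"
  shows "matrix_inv (bfgs_update H s y) =
    B - (1 / (s \<bullet> (B *v s))) *\<^sub>R outer (B *v s) (B *v s) + (1 / (s \<bullet> y)) *\<^sub>R outer y y"
    (is "_ = ?B'")
proof (rule matrix_inv_eqI[OF pos_def_bfgs_update[OF H sy]])
  define \<rho> where "\<rho> = inverse (s \<bullet> y)"
  define b where "b = s \<bullet> (B *v s)"
  have "s \<noteq> 0" using sy by auto
  then have b: "0 < b"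
    using pos_def_matrix_inv[OF H] by (simp add: b_def B pos_def_def)
  have \<rho>: "1 / (s \<bullet> y) = \<rho>" "\<rho> * (s \<bullet> y) = 1" using sy by (auto simp: \<rho>_def field_simps)
  have sym: "transpose H = H" using H by (simp add: pos_def_def)
  have HB: "H *v (B *v v) = v" for v by (simp add: B pos_def_matrix_inv_mult[OF H])
  have "(bfgs_update H s y ** ?B') *v x = mat 1 *v x" for x
  proof -
    \<comment> \<open>\<open>\<beta>\<close> and \<open>\<gamma>\<close> are the coefficients of B s
      and y in the image v of x. When the update is applied to v, all multiples of s and of H y
      cancel and x remains.\<close>
    define \<beta> where "\<beta> = ((B *v s) \<bullet> x) / b"
    define \<gamma> where "\<gamma> = \<rho> * (y \<bullet> x)"
    define v where "v = B *v x - \<beta> *\<^sub>R (B *v s) + \<gamma> *\<^sub>R y"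
    have v: "?B' *v x = v"
      unfolding v_def b_def[symmetric] \<beta>_def \<gamma>_def \<rho>
      by (simp add: matrix_vector_mult_add_rdistrib matrix_vector_mult_diff_rdistrib
        scaleR_matrix_vector_assoc[symmetric] outer_mult_vec)
    have "s \<bullet> (B *v x) = (B *v s) \<bullet> x"
      using pos_def_matrix_inv[OF H] inner_matrix_vec_transpose[of s B x] by (simp add: pos_def_def B)
    then have sv: "s \<bullet> v = \<gamma> * (s \<bullet> y)"
      using b by (simp add: v_def inner_add_right inner_diff_right \<beta>_def b_def)
    have Hv: "H *v v = x - \<beta> *\<^sub>R s + \<gamma> *\<^sub>R (H *v y)"
      by (simp add: v_def matrix_vector_right_distrib matrix_vector_mult_diff_distrib
          matrix_vector_mult_scaleR HB)
    have "(H *v y) \<bullet> v = y \<bullet> (H *v v)"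
      using inner_matrix_vec_transpose[of y H v] by (simp add: sym)
    then have Hyv: "(H *v y) \<bullet> v = y \<bullet> x - \<beta> * (s \<bullet> y) + \<gamma> * (y \<bullet> (H *v y))"
      by (simp add: Hv inner_add_right inner_diff_right inner_commute)
    have \<gamma>s: "\<rho> * (\<gamma> * (s \<bullet> y)) = \<gamma>" "\<rho> * (\<beta> * (s \<bullet> y)) = \<beta>"
      using \<rho>(2) by (simp_all add: algebra_simps)
    have "bfgs_update H s y *v v = H *v v - (\<rho> * ((H *v y) \<bullet> v)) *\<^sub>R s - (\<rho> * (s \<bullet> v)) *\<^sub>R (H *v y)
      + ((\<rho>\<^sup>2 * (y \<bullet> (H *v y)) + \<rho>) * (s \<bullet> v)) *\<^sub>R s"
      unfolding bfgs_update_expand[OF sym \<rho>_def]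
      by (simp add: matrix_vector_mult_add_rdistrib matrix_vector_mult_diff_rdistrib
        scaleR_matrix_vector_assoc[symmetric] outer_mult_vec)
    also have "\<rho> * (s \<bullet> v) = \<gamma>"
      by (simp add: sv \<gamma>s)
    also have "(\<rho>\<^sup>2 * (y \<bullet> (H *v y)) + \<rho>) * (s \<bullet> v) = \<rho> * \<gamma> * (y \<bullet> (H *v y)) + \<gamma>"
      using \<open>\<rho> * (s \<bullet> v) = \<gamma>\<close> by (simp add: power2_eq_square algebra_simps)
    also have "\<rho> * ((H *v y) \<bullet> v) = \<gamma> - \<beta> + \<rho> * \<gamma> * (y \<bullet> (H *v y))"
      using \<gamma>s(2) by (simp add: Hyv \<gamma>_def algebra_simps)
    finally have "bfgs_update H s y *v v = x"
      by (simp add: Hv algebra_simps)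
    then show ?thesis
      by (simp add: matrix_vector_mul_assoc[symmetric] v)
  qed
  then show "bfgs_update H s y ** ?B' = mat 1"
    by (simp add: matrix_eq)
qed

lemma abs_det_matrix_inv:
  fixes A :: "real^'d^'d"
  assumes "pos_def A"
  shows "\<bar>det (matrix_inv A)\<bar> = 1 / \<bar>det A\<bar>"
proof -
  have "det A * det (matrix_inv A) = 1"
    by (metis assms det_I det_mul pos_def_matrix_inv_mult(1))
  then have "\<bar>det A\<bar> * \<bar>det (matrix_inv A)\<bar> = 1"
    by (metis abs_mult abs_one)
  then show ?thesis
    using pos_def_det_nonzero[OF assms] by (simp add: field_simps)
qed

text \<open>The congruence multiplies det H by (det C)^2, hence det B by the reciprocal (s \<bullet>
  y) / (s \<bullet> B s).\<close>

lemma ln_abs_det_bfgs_inverse: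
  fixes H :: "real^'d^'d"
  assumes H: "pos_def H" and sy: "0 < s \<bullet> y" and B: "B = matrix_inv H"
  shows "ln \<bar>det (matrix_inv (bfgs_update H s y))\<bar> = ln \<bar>det B\<bar> + ln (s \<bullet> y) - ln (s \<bullet> (B *v s))"
proof -
  obtain C where C: "bfgs_update H s y = C ** H ** transpose C"
    "(det C)\<^sup>2 = (s \<bullet> (matrix_inv H *v s)) / (s \<bullet> y)"
    using bfgs_update_congruence[OF H sy] .
  have "s \<noteq> 0" using sy by auto
  then have b: "0 < s \<bullet> (B *v s)"
    using pos_def_matrix_inv[OF H] by (simp add: B pos_def_def)
  have "\<bar>det (bfgs_update H s y)\<bar> = (det C)\<^sup>2 * \<bar>det H\<bar>"
    by (simp add: C(1) det_mul abs_mult power2_eq_square)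
  also have "\<dots> = (s \<bullet> (B *v s)) / (s \<bullet> y) * \<bar>det H\<bar>"
    by (simp add: C(2) B)
  finally have d: "\<bar>det (bfgs_update H s y)\<bar> = (s \<bullet> (B *v s)) / (s \<bullet> y) * \<bar>det H\<bar>" .
  show ?thesis
    unfolding abs_det_matrix_inv[OF pos_def_bfgs_update[OF H sy]] d B abs_det_matrix_inv[OF H]
    using b sy pos_def_det_nonzero[OF H] by (simp add: ln_mult ln_div B)
qed

section \<open>The Dennis-More property\<close>

text \<open>In terms of t = tr A, the first term is at least w t, while ln |det A| grows at most
  like n ln t.\<close>

lemma trace_sub_ln_det_bounded_below:
  fixes W :: "real^'d^'d"
  assumes w: "0 < w" "\<And>u. w * (norm u)\<^sup>2 \<le> u \<bullet> (W *v u)"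
  obtains c where "\<And>A. pos_def A \<Longrightarrow> c \<le> trace (W ** A) - ln \<bar>det A\<bar>"
proof -
  define n where "n = CARD('d)"
  have n: "0 < n" by (simp add: n_def)
  \<comment> \<open>The minimum of w t - n ln t, attained at t = n / w, less the logarithm of the
    factorial in the determinant bound.\<close>
  define c where "c = n + n * ln (w / n) - ln (fact n)"
  have "c \<le> trace (W ** A) - ln \<bar>det A\<bar>" if A: "pos_def A" for A
  proof -
    define t where "t = trace A"
    have psd: "psd A" using A by (rule pos_def_psd)
    have det: "0 < \<bar>det A\<bar>" using pos_def_det_nonzero[OF A] by simp
    have le: "\<bar>det A\<bar> \<le> fact n * t ^ n"
      using psd_abs_det_le[OF psd] by (simp add: n_def t_def)
    have "0 \<le> t"
      using psd_entry_le_trace[OF psd] unfolding t_def by (meson abs_ge_zero order_trans)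
    moreover have "t \<noteq> 0"
      using det le n by (auto simp: power_0_left)
    ultimately have t: "0 < t" by simp
    have "ln \<bar>det A\<bar> \<le> ln (fact n * t ^ n)"
      using det le by simp
    also have "\<dots> = ln (fact n) + n * ln t"
      using t by (simp add: ln_mult ln_realpow)
    also have "ln t = ln (t * (w / n)) - ln (w / n)"
      using t w n by (subst ln_mult) auto
    also have "\<dots> \<le> t * (w / n) - 1 - ln (w / n)"
      using t w n by (intro diff_right_mono ln_le_minus_one) auto
    finally have "ln \<bar>det A\<bar> \<le> ln (fact n) + n * (t * (w / n) - 1 - ln (w / n))"
      using n by simp
    also have "\<dots> = w * t - c"
      using n by (simp add: c_def algebra_simps)
    also have "\<dots> \<le> trace (W ** A) - c"
      using psd_trace_mult_ge[OF psd w(2)] by (simp add: t_def)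
    finally show ?thesis by simp
  qed
  then show thesis by (rule that)
qed

text \<open>Since ln x = 2 ln (sqrt x), the tangent bound at 1, applied to sqrt x, leaves a perfect
  square.\<close>

lemma sqrt_gap_le:
  fixes x :: real
  assumes "0 < x"
  shows "(sqrt x - 1)\<^sup>2 \<le> x - 1 - ln x"
proof -
  have "ln x = 2 * ln (sqrt x)"
    using assms by (simp add: ln_sqrt)
  also have "\<dots> \<le> 2 * (sqrt x - 1)"
    using assms ln_le_minus_one[of "sqrt x"] by simp
  finally show ?thesis
    using assms by (simp add: power2_diff)
qed

lemma tendsto_one_of_ln_gap:
  fixes x a :: "nat \<Rightarrow> real"
  assumes pos: "\<And>k. 0 < x k" and gap: "\<And>k. x k - 1 - ln (x k) \<le> a k" and a: "a \<longlonglongrightarrow> 0"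
  shows "x \<longlonglongrightarrow> 1"
proof -
  have "(\<lambda>k. (sqrt (x k) - 1)\<^sup>2) \<longlonglongrightarrow> 0"
    by (rule tendsto_sandwich[OF _ _ tendsto_const a])
      (auto intro!: always_eventually order_trans[OF sqrt_gap_le[OF pos] gap])
  then have "(\<lambda>k. sqrt (x k) - 1) \<longlonglongrightarrow> 0"
    using tendsto_real_sqrt[of _ 0] by (simp add: tendsto_rabs_zero_iff)
  then have "(\<lambda>k. (sqrt (x k) - 1 + 1)\<^sup>2) \<longlonglongrightarrow> (0 + 1)\<^sup>2"
    by (intro tendsto_intros)
  then show ?thesis
    using pos by (simp add: less_imp_le)
qed

text \<open>Plain BFGS driven by given secant pairs, with no objective and no line search: the trace
  and determinant arguments see only the curvature and the length of the pairs.\<close>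

locale bfgs_sequence =
  fixes s y :: "nat \<Rightarrow> real^'d" and H :: "nat \<Rightarrow> real^'d^'d" and m M :: real
  assumes pos_def_init: "pos_def (H 0)"
    and update: "\<And>k. H (Suc k) = bfgs_update (H k) (s k) (y k)"
    and step_nonzero: "\<And>k. s k \<noteq> 0"
    and m_pos: "0 < m"
    and curvature: "\<And>k. m * (norm (s k))\<^sup>2 \<le> s k \<bullet> y k"
    and norm_y_le: "\<And>k. norm (y k) \<le> M * norm (s k)"
begin

definition B :: "nat \<Rightarrow> real^'d^'d" where
  "B k = matrix_inv (H k)"

lemma sy_pos: "0 < s k \<bullet> y k"
proof -
  have "0 < m * (norm (s k))\<^sup>2" using m_pos step_nonzero by simp
  then show ?thesis using curvature by (rule less_le_trans)
qed

lemma pos_def_H: "pos_def (H k)"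
  by (induction k) (auto simp: pos_def_init update intro!: pos_def_bfgs_update sy_pos)

lemma pos_def_B: "pos_def (B k)"
  unfolding B_def by (intro pos_def_matrix_inv pos_def_H)

lemma sBs_pos: "0 < s k \<bullet> (B k *v s k)"
  using pos_def_B step_nonzero by (simp add: pos_def_def)

lemma B_Suc: "B (Suc k) = B k - (1 / (s k \<bullet> (B k *v s k))) *\<^sub>R outer (B k *v s k) (B k *v s k)
    + (1 / (s k \<bullet> y k)) *\<^sub>R outer (y k) (y k)"
  unfolding B_def[of "Suc k"] update by (rule bfgs_inverse[OF pos_def_H sy_pos B_def])

text \<open>W stays free because two weights are needed: the identity for the averaged bound and the
  inverse of the limiting Hessian for the potential.\<close>

lemma trace_B_Suc: "trace (W ** B (Suc k)) = trace (W ** B k)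
    - ((B k *v s k) \<bullet> (W *v (B k *v s k))) / (s k \<bullet> (B k *v s k))
    + (y k \<bullet> (W *v y k)) / (s k \<bullet> y k)"
  by (simp add: B_Suc matrix_add_ldistrib matrix_mult_diff scalar_matrix_assoc[symmetric]
      matrix_scalar_ac trace_add trace_sub trace_scaleR matrix_mult_outer trace_outer
      scaleR_matrix_vector_assoc[symmetric] inner_commute)

text \<open>A telescoping budget: tr (B N) stays nonnegative, so the total decrease is at most the
  initial trace plus the increases, each of which is |y|^2 / (s \<bullet> y) \<le> M^2 / m.\<close>

lemma sum_trace_decrease_le:
  "(\<Sum>k<N. (norm (B k *v s k))\<^sup>2 / (s k \<bullet> (B k *v s k))) \<le> trace (B 0) + N * (M\<^sup>2 / m)"
proof -
  have "(\<Sum>k<N. (norm (B k *v s k))\<^sup>2 / (s k \<bullet> (B k *v s k))) \<le> trace (B 0) - trace (B N) + N * (M\<^sup>2 / m)"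
  proof (induction N)
    case (Suc N)
    have "(norm (y N))\<^sup>2 \<le> (M * norm (s N))\<^sup>2"
      using norm_y_le by (intro power_mono) auto
    also have "\<dots> = M\<^sup>2 / m * (m * (norm (s N))\<^sup>2)"
      using m_pos by (simp add: power_mult_distrib)
    also have "\<dots> \<le> M\<^sup>2 / m * (s N \<bullet> y N)"
      using m_pos by (intro mult_left_mono curvature) auto
    finally have "(norm (y N))\<^sup>2 / (s N \<bullet> y N) \<le> M\<^sup>2 / m"
      using sy_pos by (simp add: pos_divide_le_eq)
    moreover have "trace (B (Suc N)) = trace (B N) - (norm (B N *v s N))\<^sup>2 / (s N \<bullet> (B N *v s N))
        + (norm (y N))\<^sup>2 / (s N \<bullet> y N)"
      using trace_B_Suc[of "mat 1" N] by (simp add: power2_norm_eq_inner)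
    ultimately show ?case
      using Suc.IH unfolding sum.lessThan_Suc of_nat_Suc distrib_right by linarith
  qed simp
  moreover have "0 \<le> trace (B N)"
    unfolding trace_def by (intro sum_nonneg psd_diag_nonneg pos_def_psd pos_def_B)
  ultimately show ?thesis by simp
qed

text \<open>Each update lowers the potential \<open>\<psi> k\<close> by the gap \<open>a k = r k - 1 - ln (p k)\<close> up to the summable
  error \<open>c k\<close>; as \<open>p k \<le> r k\<close>, summability of the gaps forces both ratios to 1.\<close>

lemma dennis_more:
  fixes G :: "real^'d^'d" and \<epsilon> :: "nat \<Rightarrow> real"
  assumes G: "transpose G = G" and G_lower: "\<And>x. m * (norm x)\<^sup>2 \<le> x \<bullet> (G *v x)"
    and G_upper: "\<And>x. norm (G *v x) \<le> M * norm x"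
    and eps: "\<And>k. norm (y k - G *v s k) \<le> \<epsilon> k * norm (s k)" "summable \<epsilon>"
  shows "(\<lambda>k. norm (B k *v s k - G *v s k) / norm (s k)) \<longlonglongrightarrow> 0"
proof -
  define W where "W = matrix_inv G"
  have G_pos: "pos_def G"
    unfolding pos_def_def
  proof (intro conjI allI impI G)
    fix v :: "real^'d" assume "v \<noteq> 0"
    then have "0 < m * (norm v)\<^sup>2" using m_pos by simp
    then show "0 < v \<bullet> (G *v v)" using G_lower by (rule less_le_trans)
  qed
  have W_sym: "transpose W = W" and W_psd: "psd W"
    using pos_def_matrix_inv[OF G_pos] pos_def_psd by (auto simp: W_def pos_def_def)
  have GW: "G *v (W *v v) = v" and WG: "W *v (G *v v) = v" for v
    by (simp_all add: W_def pos_def_matrix_inv_mult[OF G_pos])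
  have M_pos: "0 < M"
  proof -
    have "0 < s 0 \<bullet> y 0" by (rule sy_pos)
    then have "0 < norm (y 0)" by auto
    then have "0 < M * norm (s 0)" using norm_y_le[of 0] by linarith
    then show ?thesis using step_nonzero[of 0] by (simp add: zero_less_mult_iff)
  qed
  \<comment> \<open>With u = G (W u), the upper bound on G compares |u| with |W u|, and the lower
    bound on G compares |W u|^2 with the form.\<close>
  have W_lower: "m / M\<^sup>2 * (norm u)\<^sup>2 \<le> u \<bullet> (W *v u)" for u
  proof -
    have "norm u \<le> M * norm (W *v u)"
      using G_upper[of "W *v u"] by (simp add: GW)
    then have "(norm u)\<^sup>2 \<le> (M * norm (W *v u))\<^sup>2"
      by (intro power_mono) auto
    then have "m / M\<^sup>2 * (norm u)\<^sup>2 \<le> m * (norm (W *v u))\<^sup>2"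
      using m_pos M_pos by (simp add: field_simps power_mult_distrib)
    also have "\<dots> \<le> u \<bullet> (W *v u)"
      using G_lower[of "W *v u"] by (simp add: GW inner_commute)
    finally show ?thesis .
  qed
  have W_upper: "u \<bullet> (W *v u) \<le> (norm u)\<^sup>2 / m" for u
  proof -
    have "m * (norm (W *v u))\<^sup>2 \<le> (W *v u) \<bullet> u"
      using G_lower[of "W *v u"] by (simp add: GW)
    also have "\<dots> \<le> norm (W *v u) * norm u" by (rule norm_cauchy_schwarz)
    finally have "m * norm (W *v u) \<le> norm u"
      by (cases "W *v u = 0") (auto simp: power2_eq_square)
    then have "norm u * norm (W *v u) \<le> norm u * (norm u / m)"
      using m_pos by (intro mult_left_mono) (auto simp: field_simps)
    then show ?thesis
      using norm_cauchy_schwarz[of u "W *v u"] by (simp add: power2_eq_square)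
  qed
  define b g r p where "b k = s k \<bullet> (B k *v s k)" and "g k = s k \<bullet> (G *v s k)"
    and "r k = ((B k *v s k) \<bullet> (W *v (B k *v s k))) / b k" and "p k = b k / g k" for k
  have b: "0 < b k" for k by (simp add: b_def sBs_pos)
  have g: "0 < g k" for k using G_pos step_nonzero by (simp add: g_def pos_def_def)
  have p: "0 < p k" for k using b g by (simp add: p_def)
  have pr: "p k \<le> r k" for k
  proof -
    have "(b k)\<^sup>2 \<le> g k * ((B k *v s k) \<bullet> (W *v (B k *v s k)))"
      using psd_Cauchy_Schwarz[OF pos_def_psd[OF G_pos], of "s k" "W *v (B k *v s k)"]
      by (simp add: GW b_def g_def inner_commute)
    then show ?thesis
      using b[of k] g[of k] by (simp add: p_def r_def field_simps power2_eq_square)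
  qed
  define a where "a k = r k - 1 - ln (p k)" for k
  have ap: "p k - 1 - ln (p k) \<le> a k" for k using pr by (simp add: a_def)
  have ar: "r k - 1 - ln (r k) \<le> a k" for k using pr[of k] p[of k] by (simp add: a_def)
  have a0: "0 \<le> a k" for k
    using ap[of k] ln_le_minus_one[OF p[of k]] by linarith
  define \<psi> where "\<psi> k = trace (W ** B k) - ln \<bar>det (B k)\<bar>" for k
  define c where "c k = (y k \<bullet> (W *v y k)) / (s k \<bullet> y k) - 1 - ln ((s k \<bullet> y k) / g k)" for k
  have step: "\<psi> (Suc k) = \<psi> k - a k + c k" for k
  proof -
    have "ln \<bar>det (B (Suc k))\<bar> = ln \<bar>det (B k)\<bar> + ln (s k \<bullet> y k) - ln (b k)"
      using ln_abs_det_bfgs_inverse[OF pos_def_H sy_pos B_def, of k]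
      by (simp add: B_def[of "Suc k"] update b_def)
    moreover have "trace (W ** B (Suc k)) = trace (W ** B k) - r k + (y k \<bullet> (W *v y k)) / (s k \<bullet> y k)"
      using trace_B_Suc[of W k] by (simp add: r_def b_def)
    ultimately show ?thesis
      using b[of k] g[of k] sy_pos[of k] by (simp add: \<psi>_def a_def c_def p_def ln_div)
  qed
  have eps0: "0 \<le> \<epsilon> k" for k
    using order_trans[OF norm_ge_zero eps(1)[of k]] step_nonzero[of k] by (simp add: zero_le_mult_iff)
  \<comment> \<open>The error in the potential is quadratic in \<open>\<epsilon>\<close>; a uniform
    bound E reduces it to a multiple of the summable \<open>\<epsilon>\<close>.\<close>
  obtain E where E: "\<And>k. \<epsilon> k \<le> E"
    using summable_imp_Bseq[OF eps(2)] unfolding Bseq_def by (metis abs_le_D1 real_norm_def)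
  have c_le: "c k \<le> E / m\<^sup>2 * \<epsilon> k" for k
  proof -
    define e where "e = y k - G *v s k"
    have e: "norm e \<le> \<epsilon> k * norm (s k)" using eps(1) by (simp add: e_def)
    have y: "y k = G *v s k + e" by (simp add: e_def)
    have We: "(G *v s k) \<bullet> (W *v e) = s k \<bullet> e"
      using inner_sym_matrix[OF W_sym, of "G *v s k" e] inner_commute[of e "s k"] by (simp only: WG)
    \<comment> \<open>The first-order terms s \<bullet> e of this identity and of the next one
      cancel in the sum, which leaves only e \<bullet> W e.\<close>
    have yWy: "y k \<bullet> (W *v y k) - s k \<bullet> y k = s k \<bullet> e + e \<bullet> (W *v e)"
      unfolding y by (simp add: matrix_vector_right_distrib WG inner_add_left inner_add_right We
          inner_commute[of e "s k"] inner_commute[of "G *v s k" "s k"])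
    have ys: "g k - s k \<bullet> y k = - (s k \<bullet> e)"
      by (simp add: g_def y inner_add_right)
    have "e \<bullet> (W *v e) \<le> (norm e)\<^sup>2 / m" by (rule W_upper)
    also have "(norm e)\<^sup>2 \<le> (\<epsilon> k * norm (s k))\<^sup>2" using e by (intro power_mono) auto
    also have "\<dots> \<le> E * \<epsilon> k * (norm (s k))\<^sup>2"
      using mult_right_mono[OF E[of k] eps0[of k]]
      by (simp add: power_mult_distrib power2_eq_square[of "\<epsilon> k"] mult_right_mono)
    finally have eWe: "e \<bullet> (W *v e) \<le> E / m * \<epsilon> k * (norm (s k))\<^sup>2"
      using m_pos by (simp add: divide_right_mono)
    \<comment> \<open>The ratio is inverted before the tangent bound on the logarithm is used, so
      that both fractions have the denominator s \<bullet> y and the cancellation becomes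
      visible.\<close>
    have "c k \<le> (y k \<bullet> (W *v y k)) / (s k \<bullet> y k) - 1 + (g k / (s k \<bullet> y k) - 1)"
    proof -
      have "- ln ((s k \<bullet> y k) / g k) = ln (g k / (s k \<bullet> y k))"
        using g[of k] sy_pos[of k] by (simp add: ln_div)
      also have "\<dots> \<le> g k / (s k \<bullet> y k) - 1"
        using g[of k] sy_pos[of k] by (intro ln_le_minus_one) simp
      finally show ?thesis by (simp add: c_def)
    qed
    also have "\<dots> = ((y k \<bullet> (W *v y k) - s k \<bullet> y k) + (g k - s k \<bullet> y k)) / (s k \<bullet> y k)"
      using sy_pos[of k] by (simp add: diff_divide_distrib add_divide_distrib)
    also have "\<dots> = e \<bullet> (W *v e) / (s k \<bullet> y k)"
      by (simp add: yWy ys)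
    also have "\<dots> \<le> E / m * \<epsilon> k * (norm (s k))\<^sup>2 / (s k \<bullet> y k)"
      using eWe sy_pos[of k] by (intro divide_right_mono) auto
    also have "\<dots> \<le> E / m * \<epsilon> k * (norm (s k))\<^sup>2 / (m * (norm (s k))\<^sup>2)"
      using curvature[of k] m_pos step_nonzero[of k] eps0[of k] E[of k] sy_pos[of k]
      by (intro divide_left_mono mult_nonneg_nonneg mult_pos_pos) auto
    also have "\<dots> = E / m\<^sup>2 * \<epsilon> k"
      using m_pos step_nonzero[of k] by (simp add: field_simps power2_eq_square)
    finally show ?thesis .
  qed
  obtain \<psi>0 where \<psi>0: "\<And>A. pos_def A \<Longrightarrow> \<psi>0 \<le> trace (W ** A) - ln \<bar>det A\<bar>"
    using trace_sub_ln_det_bounded_below[OF _ W_lower] m_pos M_pos by auto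
  have "(\<Sum>k<N. a k) \<le> \<psi> 0 - \<psi>0 + E / m\<^sup>2 * suminf \<epsilon>" for N
  proof -
    have "(\<Sum>k<N. a k) = \<psi> 0 - \<psi> N + (\<Sum>k<N. c k)"
      by (induction N) (auto simp: step)
    also have "(\<Sum>k<N. c k) \<le> E / m\<^sup>2 * (\<Sum>k<N. \<epsilon> k)"
      unfolding sum_distrib_left by (intro sum_mono c_le)
    also have "\<dots> \<le> E / m\<^sup>2 * suminf \<epsilon>"
      using m_pos order_trans[OF eps0[of 0] E[of 0]] eps0
      by (intro mult_left_mono sum_le_suminf eps(2)) auto
    finally show ?thesis
      using \<psi>0[OF pos_def_B[of N]] by (simp add: \<psi>_def)
  qed
  then have "summable a"
    using a0 by (intro summableI_nonneg_bounded) auto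
  then have a_lim: "a \<longlonglongrightarrow> 0" by (rule summable_LIMSEQ_zero)
  have "0 < r k" for k using p[of k] pr[of k] by linarith
  then have r_lim: "r \<longlonglongrightarrow> 1" using ar a_lim by (rule tendsto_one_of_ln_gap)
  have p_lim: "p \<longlonglongrightarrow> 1" using p ap a_lim by (rule tendsto_one_of_ln_gap)
  \<comment> \<open>The bracket is the squared W-norm of (B - G) s divided by s \<bullet> G s.
    Passing to the Euclidean norm costs M^2 / m, and s \<bullet> G s \<le> M |s|^2 the third factor
    M.\<close>
  have "(\<lambda>k. M ^ 3 / m * (r k * p k - 2 * p k + 1)) \<longlonglongrightarrow> M ^ 3 / m * (1 * 1 - 2 * 1 + 1)"
    by (intro tendsto_intros r_lim p_lim)
  then have upper_lim: "(\<lambda>k. M ^ 3 / m * (r k * p k - 2 * p k + 1)) \<longlonglongrightarrow> 0"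
    by simp
  have bound: "(norm (B k *v s k - G *v s k) / norm (s k))\<^sup>2 \<le> M ^ 3 / m * (r k * p k - 2 * p k + 1)" for k
  proof -
    define v where "v = B k *v s k - G *v s k"
    have W1: "(B k *v s k) \<bullet> s k = b k" "(G *v s k) \<bullet> (W *v (B k *v s k)) = b k"
      using inner_sym_matrix[OF W_sym, of "G *v s k" "B k *v s k"] by (simp_all add: b_def WG inner_commute)
    have rb: "(B k *v s k) \<bullet> (W *v (B k *v s k)) = r k * b k"
      using b[of k] by (simp add: r_def)
    have "v \<bullet> (W *v v) = r k * b k - 2 * b k + g k"
      by (simp add: v_def matrix_vector_mult_diff_distrib WG inner_diff_left inner_diff_right W1 rb
          g_def inner_commute[of "G *v s k" "s k"])
    also have "\<dots> = (r k * p k - 2 * p k + 1) * g k"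
      using g[of k] by (simp add: p_def field_simps)
    finally have vWv: "v \<bullet> (W *v v) = (r k * p k - 2 * p k + 1) * g k" .
    have "0 \<le> v \<bullet> (W *v v)" using W_psd by (simp add: psd_def)
    then have nonneg: "0 \<le> r k * p k - 2 * p k + 1"
      using vWv g[of k] by (simp add: zero_le_mult_iff)
    have "g k \<le> norm (s k) * norm (G *v s k)" unfolding g_def by (rule norm_cauchy_schwarz)
    also have "\<dots> \<le> norm (s k) * (M * norm (s k))" by (intro mult_left_mono G_upper) auto
    finally have gM: "g k \<le> M * (norm (s k))\<^sup>2" by (simp add: power2_eq_square algebra_simps)
    have "(norm v)\<^sup>2 \<le> M\<^sup>2 / m * (v \<bullet> (W *v v))"
      using W_lower[of v] m_pos M_pos by (simp add: field_simps)
    also have "\<dots> \<le> M\<^sup>2 / m * ((r k * p k - 2 * p k + 1) * (M * (norm (s k))\<^sup>2))"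
      unfolding vWv using nonneg gM m_pos by (intro mult_left_mono) auto
    finally have "(norm v)\<^sup>2 / (norm (s k))\<^sup>2 \<le> M ^ 3 / m * (r k * p k - 2 * p k + 1)"
      using step_nonzero[of k] by (simp add: pos_divide_le_eq power3_eq_cube power2_eq_square mult_ac)
    then show ?thesis by (simp add: v_def power_divide)
  qed
  have "(\<lambda>k. (norm (B k *v s k - G *v s k) / norm (s k))\<^sup>2) \<longlonglongrightarrow> 0"
    by (rule tendsto_sandwich[OF always_eventually always_eventually tendsto_const upper_lim])
      (use bound in auto)
  then have "(\<lambda>k. sqrt ((norm (B k *v s k - G *v s k) / norm (s k))\<^sup>2)) \<longlonglongrightarrow> sqrt 0"
    by (rule tendsto_real_sqrt)
  then show ?thesis
    by simp
qed

end

section \<open>Strongly convex objectives and unit steps\<close>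

lemma GDERIV_unique: "GDERIV F x :> D \<Longrightarrow> GDERIV F x :> D' \<Longrightarrow> D = D'"
  unfolding gderiv_def by (metis has_derivative_unique inner_commute vector_eq_ldot)

text \<open>\<open>grad\<close> is a definite description, so existence and uniqueness are both
  required; the adjoint of the derivative, applied to 1, is the Riesz representative.\<close>

lemma GDERIV_grad:
  fixes F :: "'a::euclidean_space \<Rightarrow> real"
  assumes "F differentiable (at x)"
  shows "GDERIV F x :> grad F x"
proof -
  obtain F' where F': "(F has_derivative F') (at x)"
    using assms by (auto simp: differentiable_def)
  have "F' h = h \<bullet> adjoint F' 1" for h
    using adjoint_works[OF has_derivative_linear[OF F'], of h 1] by simp
  then have "F' = (\<lambda>h. h \<bullet> adjoint F' 1)" by auto
  then have D: "GDERIV F x :> adjoint F' 1"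
    using F' unfolding gderiv_def by metis
  then have "grad F x = adjoint F' 1"
    unfolding grad_def by (intro the_equality) (auto intro: GDERIV_unique)
  with D show ?thesis by simp
qed

locale strongly_convex_region =
  fixes F :: "real^'d \<Rightarrow> real" and U :: "(real^'d) set" and m M :: real
  assumes convex_U: "convex U"
    and diff: "\<And>u. u \<in> U \<Longrightarrow> F differentiable (at u)"
    and grad_diff: "\<And>u. u \<in> U \<Longrightarrow> grad F differentiable (at u)"
    and hess_bounds: "\<And>u. u \<in> U \<Longrightarrow>
      loewner_le (m *\<^sub>R mat 1) (hess F u) \<and> loewner_le (hess F u) (M *\<^sub>R mat 1)"
    and m_pos: "0 < m" and m_le_M: "m \<le> M"
begin

lemma grad_has_derivative:
  assumes "u \<in> U"
  shows "(grad F has_derivative (\<lambda>h. hess F u *v h)) (at u)"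
proof -
  have D: "(grad F has_derivative frechet_derivative (grad F) (at u)) (at u)"
    using grad_diff[OF assms] by (simp add: frechet_derivative_works)
  have "(\<lambda>h. hess F u *v h) = frechet_derivative (grad F) (at u)"
    using matrix_vector_mul(2)[OF has_derivative_linear[OF D]] by (simp add: hess_def)
  with D show ?thesis by simp
qed

text \<open>Symmetry is part of \<open>psd\<close>, hence of the Loewner bounds; no theorem on mixed
  second derivatives is invoked.\<close>

lemma hess_sym: "u \<in> U \<Longrightarrow> transpose (hess F u) = hess F u"
proof -
  assume "u \<in> U"
  then have "transpose (hess F u - m *\<^sub>R mat 1) = hess F u - m *\<^sub>R mat 1"
    using hess_bounds by (auto simp: loewner_le_def psd_def)
  then show ?thesis
    by (simp add: transpose_diff transpose_scaleR)
qed

lemma hess_lower: "u \<in> U \<Longrightarrow> m * (norm v)\<^sup>2 \<le> v \<bullet> (hess F u *v v)"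
  using hess_bounds[of u] by (auto simp: loewner_le_def psd_def matrix_vector_mult_diff_rdistrib
      scaleR_matrix_vector_assoc[symmetric] inner_diff_right power2_norm_eq_inner)

lemma hess_upper: "u \<in> U \<Longrightarrow> v \<bullet> (hess F u *v v) \<le> M * (norm v)\<^sup>2"
  using hess_bounds[of u] by (auto simp: loewner_le_def psd_def matrix_vector_mult_diff_rdistrib
      scaleR_matrix_vector_assoc[symmetric] inner_diff_right power2_norm_eq_inner)

text \<open>From the form to the operator norm without eigenvalues: Cauchy-Schwarz for the Hessian
  form, applied to v and its own image w, gives |w|^4 \<le> M |w|^2 M |v|^2.\<close>

lemma norm_hess_le:
  assumes u: "u \<in> U"
  shows "norm (hess F u *v v) \<le> M * norm v"
proof -
  have M: "0 < M" using m_pos m_le_M by simp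
  define w where "w = hess F u *v v"
  have "psd (hess F u)"
    using hess_sym[OF u] order_trans[OF _ hess_lower[OF u]] m_pos by (auto simp: psd_def)
  then have "(w \<bullet> w)\<^sup>2 \<le> (w \<bullet> (hess F u *v w)) * (v \<bullet> (hess F u *v v))"
    using psd_Cauchy_Schwarz[of "hess F u" w v] by (simp add: w_def)
  also have "\<dots> \<le> (M * (norm w)\<^sup>2) * (M * (norm v)\<^sup>2)"
  proof (intro mult_mono hess_upper u)
    have "0 \<le> m * (norm v)\<^sup>2" using m_pos by simp
    then show "0 \<le> v \<bullet> (hess F u *v v)" using hess_lower[OF u, of v] by linarith
  qed (use M in simp)
  finally have "(norm w)\<^sup>2 * (norm w)\<^sup>2 \<le> (norm w)\<^sup>2 * (M * norm v)\<^sup>2"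
    by (simp add: power2_norm_eq_inner[symmetric] power2_eq_square mult_ac)
  then have "(norm w)\<^sup>2 \<le> (M * norm v)\<^sup>2"
    by (cases "w = 0") (simp, rule mult_left_le_imp_le[of "(norm w)\<^sup>2"], auto)
  then show ?thesis
    unfolding w_def by (rule power2_le_imp_le) (use M in simp)
qed

lemma segment_in_U: "u \<in> U \<Longrightarrow> v \<in> U \<Longrightarrow> 0 \<le> t \<Longrightarrow> t \<le> 1 \<Longrightarrow> u + t *\<^sub>R (v - u) \<in> U"
  using convexD_alt[OF convex_U, of u v t] by (simp add: algebra_simps)

lemma grad_lipschitz:
  assumes "u \<in> U" "v \<in> U"
  shows "norm (grad F v - grad F u) \<le> M * norm (v - u)"
proof (rule differentiable_bound[OF convex_U _ _ assms(2,1)])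
  fix x assume x: "x \<in> U"
  show "(grad F has_derivative (\<lambda>h. hess F x *v h)) (at x within U)"
    using grad_has_derivative[OF x] by (rule has_derivative_at_withinI)
  show "onorm (\<lambda>h. hess F x *v h) \<le> M"
    using norm_hess_le[OF x] by (rule onorm_le)
qed

text \<open>Instead of averaging the Hessian over the segment, a scalar function along it is shown
  to be nondecreasing; its derivative is the Hessian form minus its lower bound.\<close>

lemma grad_strongly_monotone:
  assumes "u \<in> U" "v \<in> U"
  shows "m * (norm (v - u))\<^sup>2 \<le> (v - u) \<bullet> (grad F v - grad F u)"
proof -
  define d where "d = v - u"
  define h where "h t = d \<bullet> grad F (u + t *\<^sub>R d) - t * (m * (norm d)\<^sup>2)" for t
  have "h 0 \<le> h 1"
  proof (rule DERIV_nonneg_imp_nondecreasing[of 0 1 h])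
    fix t :: real assume t: "0 \<le> t" "t \<le> 1"
    then have U: "u + t *\<^sub>R d \<in> U" unfolding d_def using segment_in_U assms by blast
    have line: "((\<lambda>t. u + t *\<^sub>R d) has_derivative (\<lambda>x. x *\<^sub>R d)) (at t)"
      by (auto intro!: derivative_eq_intros)
    have "((\<lambda>t. grad F (u + t *\<^sub>R d)) has_derivative (\<lambda>x. hess F (u + t *\<^sub>R d) *v (x *\<^sub>R d))) (at t)"
      using has_derivative_compose[OF line grad_has_derivative[OF U]] by simp
    then have "(h has_derivative (\<lambda>x. d \<bullet> (hess F (u + t *\<^sub>R d) *v (x *\<^sub>R d)) - x * (m * (norm d)\<^sup>2))) (at t)"
      unfolding h_def by (auto intro!: derivative_eq_intros)
    then have "(h has_real_derivative (d \<bullet> (hess F (u + t *\<^sub>R d) *v d) - m * (norm d)\<^sup>2)) (at t)"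
      unfolding has_field_derivative_def
      by (rule has_derivative_eq_rhs) (auto simp: matrix_vector_mult_scaleR algebra_simps)
    moreover have "0 \<le> d \<bullet> (hess F (u + t *\<^sub>R d) *v d) - m * (norm d)\<^sup>2"
      using hess_lower[OF U] by simp
    ultimately show "\<exists>y. (h has_real_derivative y) (at t) \<and> 0 \<le> y" by blast
  qed simp
  then show ?thesis
    by (simp add: h_def d_def inner_diff_right)
qed

lemma strong_convexity:
  assumes "u \<in> U" "v \<in> U"
  shows "F u + grad F u \<bullet> (v - u) + m / 2 * (norm (v - u))\<^sup>2 \<le> F v"
proof -
  define d where "d = v - u"
  define h where "h t = F (u + t *\<^sub>R d) - t * (grad F u \<bullet> d) - t\<^sup>2 * (m / 2 * (norm d)\<^sup>2)" for t
  have "h 0 \<le> h 1"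
  proof (rule DERIV_nonneg_imp_nondecreasing[of 0 1 h])
    fix t :: real assume t: "0 \<le> t" "t \<le> 1"
    then have U: "u + t *\<^sub>R d \<in> U" unfolding d_def using segment_in_U assms by blast
    have line: "((\<lambda>t. u + t *\<^sub>R d) has_derivative (\<lambda>x. x *\<^sub>R d)) (at t)"
      by (auto intro!: derivative_eq_intros)
    have "((\<lambda>t. F (u + t *\<^sub>R d)) has_derivative (\<lambda>x. (x *\<^sub>R d) \<bullet> grad F (u + t *\<^sub>R d))) (at t)"
      using has_derivative_compose[OF line GDERIV_grad[OF diff[OF U], unfolded gderiv_def]] by simp
    then have "((\<lambda>t. F (u + t *\<^sub>R d)) has_real_derivative d \<bullet> grad F (u + t *\<^sub>R d)) (at t)"
      unfolding has_field_derivative_def by (simp add: mult_commute_abs)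
    then have "(h has_real_derivative
        d \<bullet> grad F (u + t *\<^sub>R d) - grad F u \<bullet> d - 2 * t * (m / 2 * (norm d)\<^sup>2)) (at t)"
      unfolding h_def by (auto intro!: derivative_eq_intros)
    moreover have "0 \<le> d \<bullet> grad F (u + t *\<^sub>R d) - grad F u \<bullet> d - 2 * t * (m / 2 * (norm d)\<^sup>2)"
    \<comment> \<open>Monotonicity between u and u + t d carries a factor t that has to be
      cancelled; at t = 0 the derivative is zero.\<close>
    proof (cases "t = 0")
      case False
      then have "0 < t" using t by simp
      have "t * (t * (m * (norm d)\<^sup>2)) \<le> t * (d \<bullet> (grad F (u + t *\<^sub>R d) - grad F u))"
        using grad_strongly_monotone[OF assms(1) U] by (simp add: power_mult_distrib power2_eq_square mult_ac)
      then have "t * (m * (norm d)\<^sup>2) \<le> d \<bullet> (grad F (u + t *\<^sub>R d) - grad F u)"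
        using \<open>0 < t\<close> by simp
      then show ?thesis
        by (simp add: inner_diff_right inner_commute)
    qed (simp add: inner_commute)
    ultimately show "\<exists>y. (h has_real_derivative y) (at t) \<and> 0 \<le> y" by blast
  qed simp
  then show ?thesis
    by (simp add: h_def d_def)
qed

text \<open>Each parameter bound serves one half of the threshold; for the second, |y|^2 \<le> M^2
  |s|^2 < Mcur m |s|^2. Distinct endpoints make the inequalities strict.\<close>

lemma direct_test_holds:
  assumes "u \<in> U" "v \<in> U" "u \<noteq> v" "0 < mcur" "mcur < m" "M\<^sup>2 / m < Mcur"
  shows "direct_test mcur Mcur (v - u) (grad F v - grad F u)"
proof -
  define s y where "s = v - u" and "y = grad F v - grad F u"
  have s: "0 < (norm s)\<^sup>2" using assms(3) by (simp add: s_def)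
  have sy: "m * (norm s)\<^sup>2 \<le> s \<bullet> y"
    unfolding s_def y_def by (rule grad_strongly_monotone[OF assms(1,2)])
  have Mcur: "0 < Mcur"
    using assms(6) m_pos by (smt (verit) divide_nonneg_pos zero_le_power2)
  have "mcur * (norm s)\<^sup>2 < m * (norm s)\<^sup>2"
    using s assms(5) by simp
  moreover have "(norm y)\<^sup>2 / Mcur < m * (norm s)\<^sup>2"
  proof -
    have "(norm y)\<^sup>2 \<le> (M * norm s)\<^sup>2"
      unfolding s_def y_def by (intro power_mono grad_lipschitz assms) auto
    also have "\<dots> < Mcur * (m * (norm s)\<^sup>2)"
      using assms(6) m_pos s by (simp add: power_mult_distrib pos_divide_less_eq mult.assoc[symmetric])
    finally show ?thesis
      using Mcur by (simp add: pos_divide_less_eq mult.commute)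
  qed
  ultimately show ?thesis
    using sy by (simp add: direct_test_def curv_threshold_def s_def[symmetric] y_def[symmetric])
qed

end

section \<open>Unit-step BFGS inside the region: linear rate and summable errors\<close>

locale unit_step_bfgs = strongly_convex_region F U m M
  for F :: "real^'d \<Rightarrow> real" and U m M +
  fixes z :: "nat \<Rightarrow> real^'d" and H :: "nat \<Rightarrow> real^'d^'d" and zs :: "real^'d" and \<alpha> :: real
  assumes z_in_U: "\<And>k. z k \<in> U"
    and zs_in_U: "zs \<in> U" and stationary: "grad F zs = 0"
    and grad_nonzero: "\<And>k. grad F (z k) \<noteq> 0"
    and H_pos: "\<And>k. pos_def (H k)"
    and z_Suc: "\<And>k. z (Suc k) = z k + search_dir F (H k) (z k)"
    and H_Suc: "\<And>k. H (Suc k) = bfgs_update (H k) (sdiff z k) (ydiff F z k)"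
    and alpha_pos: "0 < \<alpha>"
    and decrease: "\<And>k. armijo F \<alpha> (z k) (search_dir F (H k) (z k)) 1"
begin

lemma sdiff_eq: "sdiff z k = - (H k *v grad F (z k))"
  by (simp add: sdiff_def z_Suc search_dir_def)

lemma sdiff_nonzero: "sdiff z k \<noteq> 0"
  using pos_def_kernel[OF H_pos] grad_nonzero by (auto simp: sdiff_eq)

sublocale bfgs_sequence "sdiff z" "ydiff F z" H m M
proof
  show "m * (norm (sdiff z k))\<^sup>2 \<le> sdiff z k \<bullet> ydiff F z k" for k
    unfolding sdiff_def ydiff_def by (intro grad_strongly_monotone z_in_U)
  show "norm (ydiff F z k) \<le> M * norm (sdiff z k)" for k
    unfolding sdiff_def ydiff_def by (intro grad_lipschitz z_in_U)
qed (fact H_pos H_Suc sdiff_nonzero m_pos)+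

text \<open>Unit length matters here: a step length \<lambda> would leave a factor \<lambda> in
  front of the gradient, both in the trace quotient and in the Dennis-More residual.\<close>

lemma B_sdiff: "B k *v sdiff z k = - grad F (z k)"
proof -
  have "sdiff z k = H k *v (- grad F (z k))"
    by (simp add: sdiff_eq vec_eq_iff matrix_vector_mult_def sum_negf)
  then show ?thesis
    by (simp add: B_def pos_def_matrix_inv_mult[OF H_pos])
qed

lemma norm_grad_ge: "m * norm (z k - zs) \<le> norm (grad F (z k))"
proof -
  have "m * (norm (z k - zs))\<^sup>2 \<le> (z k - zs) \<bullet> grad F (z k)"
    using grad_strongly_monotone[OF zs_in_U z_in_U] by (simp add: stationary)
  also have "\<dots> \<le> norm (z k - zs) * norm (grad F (z k))" by (rule norm_cauchy_schwarz)
  finally show ?thesis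
    by (cases "z k = zs") (auto simp: power2_eq_square)
qed

lemma gap_lower: "m / 2 * (norm (z k - zs))\<^sup>2 \<le> F (z k) - F zs"
  using strong_convexity[OF zs_in_U z_in_U, of k] by (simp add: stationary)

text \<open>A gradient-domination inequality. Dropping the quadratic term gives 1/m in place of the
  sharp 1/(2m), which only affects the rate constant.\<close>

lemma gap_upper: "F (z k) - F zs \<le> (norm (grad F (z k)))\<^sup>2 / m"
proof -
  have "0 \<le> m / 2 * (norm (zs - z k))\<^sup>2" using m_pos by simp
  then have "F (z k) - F zs \<le> grad F (z k) \<bullet> (z k - zs)"
    using strong_convexity[OF z_in_U zs_in_U, of k] by (simp add: inner_diff_right)
  also have "\<dots> \<le> norm (grad F (z k)) * norm (z k - zs)" by (rule norm_cauchy_schwarz)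
  also have "\<dots> \<le> norm (grad F (z k)) * (norm (grad F (z k)) / m)"
    using norm_grad_ge[of k] m_pos by (intro mult_left_mono) (auto simp: field_simps)
  finally show ?thesis by (simp add: power2_eq_square)
qed

text \<open>The quotients \<open>r k\<close> are bounded only on average, which suffices: the tangent inequality
  \<open>1 / r \<ge> 2 / Q - r / Q\<^sup>2\<close> bounds the sum of \<open>1 / r k\<close>, and with it the exponent of the decrease,
  from below linearly.\<close>

lemma summable_error: "summable (\<lambda>k. norm (z k - zs))"
proof -
  define g b r \<Delta> where "g k = grad F (z k)" and "b k = sdiff z k \<bullet> (B k *v sdiff z k)"
    and "r k = (norm (g k))\<^sup>2 / b k" and "\<Delta> k = F (z k) - F zs" for k
  \<comment> \<open>Q bounds the increase of the trace per step, so the first N quotients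
    \<open>r k\<close> have average at most Q + T / N.\<close>
  define Q T where "Q = M\<^sup>2 / m" and "T = trace (B 0)"
  have Q: "0 < Q" using m_pos m_le_M by (simp add: Q_def)
  have b: "0 < b k" for k by (simp add: b_def sBs_pos)
  have r: "0 < r k" for k using b grad_nonzero by (simp add: r_def g_def)
  have \<Delta>0: "0 \<le> \<Delta> k" for k
    unfolding \<Delta>_def by (rule order_trans[OF _ gap_lower]) (use m_pos in simp)
  have step: "\<Delta> (Suc k) \<le> exp (- (\<alpha> * m * (1 / r k))) * \<Delta> k" for k
  proof -
    have "F (z (Suc k)) \<le> F (z k) + \<alpha> * (g k \<bullet> sdiff z k)"
      using decrease[of k] by (simp add: armijo_def z_Suc sdiff_def g_def)
    also have "g k \<bullet> sdiff z k = - b k"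
      by (simp add: b_def B_sdiff g_def inner_commute)
    finally have "\<Delta> (Suc k) \<le> \<Delta> k - \<alpha> * b k" by (simp add: \<Delta>_def)
    moreover have "\<alpha> * m * (1 / r k) * \<Delta> k \<le> \<alpha> * b k"
    proof -
      have "\<alpha> * m * (1 / r k) * \<Delta> k \<le> \<alpha> * m * (1 / r k) * ((norm (g k))\<^sup>2 / m)"
        using gap_upper[of k] r[of k] m_pos alpha_pos unfolding \<Delta>_def g_def
        by (intro mult_left_mono) (auto simp: less_imp_le)
      also have "\<dots> = \<alpha> * b k"
        using m_pos b[of k] grad_nonzero[of k] by (simp add: r_def g_def)
      finally show ?thesis .
    qed
    ultimately have "\<Delta> (Suc k) \<le> (1 + - (\<alpha> * m * (1 / r k))) * \<Delta> k"
      by (simp add: algebra_simps)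
    also have "\<dots> \<le> exp (- (\<alpha> * m * (1 / r k))) * \<Delta> k"
      by (intro mult_right_mono exp_ge_add_one_self \<Delta>0)
    finally show ?thesis .
  qed
  have prod: "\<Delta> N \<le> exp (- (\<alpha> * m * (\<Sum>k<N. 1 / r k))) * \<Delta> 0" for N
  proof (induction N)
    case (Suc N)
    have "\<Delta> (Suc N) \<le> exp (- (\<alpha> * m * (1 / r N))) * \<Delta> N" by (rule step)
    also have "\<dots> \<le> exp (- (\<alpha> * m * (1 / r N))) * (exp (- (\<alpha> * m * (\<Sum>k<N. 1 / r k))) * \<Delta> 0)"
      by (intro mult_left_mono Suc.IH) simp
    finally show ?case
      by (simp add: exp_add[symmetric] mult.assoc[symmetric] distrib_left add.commute)
  qed simp
  have sum_ge: "N / Q - T / Q\<^sup>2 \<le> (\<Sum>k<N. 1 / r k)" for N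
  proof -
    have tangent: "2 / Q - r k / Q\<^sup>2 \<le> 1 / r k" for k
    proof -
      have "0 \<le> (r k - Q)\<^sup>2 / (Q\<^sup>2 * r k)" using r[of k] by simp
      also have "\<dots> = 1 / r k - (2 / Q - r k / Q\<^sup>2)"
        using r[of k] Q by (simp add: field_simps power2_eq_square)
      finally show ?thesis by simp
    qed
    have "(\<Sum>k<N. r k) \<le> T + N * Q"
      using sum_trace_decrease_le[of N] by (simp add: B_sdiff r_def b_def g_def T_def Q_def)
    then have "(\<Sum>k<N. r k) / Q\<^sup>2 \<le> (T + N * Q) / Q\<^sup>2"
      by (intro divide_right_mono) auto
    also have "(T + N * Q) / Q\<^sup>2 = T / Q\<^sup>2 + N / Q"
      using Q by (simp add: field_simps power2_eq_square)
    finally have "(\<Sum>k<N. r k) / Q\<^sup>2 \<le> T / Q\<^sup>2 + N / Q" .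
    moreover have "N * (2 / Q) = 2 * (N / Q)"
      by simp
    ultimately have "N / Q - T / Q\<^sup>2 \<le> N * (2 / Q) - (\<Sum>k<N. r k) / Q\<^sup>2"
      by linarith
    also have "\<dots> = (\<Sum>k<N. 2 / Q - r k / Q\<^sup>2)"
      by (simp add: sum_subtractf sum_divide_distrib)
    also have "\<dots> \<le> (\<Sum>k<N. 1 / r k)"
      by (intro sum_mono tangent)
    finally show ?thesis .
  qed
  \<comment> \<open>The exponent is halved because the gap controls the square of the error. C
    collects 2/m from the lower bound on the gap and the offset T / Q^2 due to the initial
    trace.\<close>
  define \<theta> where "\<theta> = exp (- (\<alpha> * m / Q / 2))"
  define C where "C = 2 / m * (exp (\<alpha> * m * T / Q\<^sup>2) * \<Delta> 0)"
  have \<theta>: "0 < \<theta>" "\<theta> < 1"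
    using alpha_pos m_pos Q by (auto simp: \<theta>_def)
  have "norm (z N - zs) \<le> sqrt C * \<theta> ^ N" for N
  proof -
    note prod[of N]
    also have "exp (- (\<alpha> * m * (\<Sum>k<N. 1 / r k))) * \<Delta> 0 \<le> exp (- (\<alpha> * m * (N / Q - T / Q\<^sup>2))) * \<Delta> 0"
    proof (rule mult_right_mono[OF _ \<Delta>0])
      have "\<alpha> * m * (N / Q - T / Q\<^sup>2) \<le> \<alpha> * m * (\<Sum>k<N. 1 / r k)"
        using alpha_pos m_pos by (intro mult_left_mono sum_ge) simp
      then show "exp (- (\<alpha> * m * (\<Sum>k<N. 1 / r k))) \<le> exp (- (\<alpha> * m * (N / Q - T / Q\<^sup>2)))"
        by simp
    qed
    also have "exp (- (\<alpha> * m * (N / Q - T / Q\<^sup>2))) = exp (\<alpha> * m * T / Q\<^sup>2) * (\<theta> ^ N)\<^sup>2"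
      by (simp add: \<theta>_def exp_of_nat_mult[symmetric] exp_add[symmetric] power_mult[symmetric] right_diff_distrib)
    finally have "2 / m * \<Delta> N \<le> 2 / m * (exp (\<alpha> * m * T / Q\<^sup>2) * (\<theta> ^ N)\<^sup>2 * \<Delta> 0)"
      using m_pos by (intro mult_left_mono) auto
    moreover have "(norm (z N - zs))\<^sup>2 \<le> 2 / m * \<Delta> N"
      using gap_lower[of N] m_pos by (simp add: \<Delta>_def field_simps)
    ultimately have "(norm (z N - zs))\<^sup>2 \<le> C * (\<theta> ^ N)\<^sup>2"
      by (simp add: C_def mult_ac)
    then have "sqrt ((norm (z N - zs))\<^sup>2) \<le> sqrt (C * (\<theta> ^ N)\<^sup>2)"
      by (rule real_sqrt_le_mono)
    then show ?thesis
      using \<theta> by (simp add: real_sqrt_mult)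
  qed
  then have "\<And>N. norm (norm (z N - zs)) \<le> sqrt C * \<theta> ^ N" by simp
  moreover have "summable (\<lambda>N. sqrt C * \<theta> ^ N)"
    using \<theta> by (intro summable_mult summable_geometric) simp
  ultimately show ?thesis
    by (metis summable_comparison_test')
qed

lemma z_tendsto: "z \<longlonglongrightarrow> zs"
  using summable_LIMSEQ_zero[OF summable_error] by (simp add: LIM_zero_iff tendsto_norm_zero_iff)

end

lemma q_superlinear_offset:
  assumes "q_superlinear (\<lambda>k. z (k + n)) zs"
  shows "q_superlinear z zs"
  using assms LIMSEQ_offset[of z n zs] LIMSEQ_offset[of "\<lambda>k. norm (z (Suc k) - zs) / norm (z k - zs)" n 0]
  by (simp add: q_superlinear_def)

section \<open>Superlinear rate near the limit\<close>

context unit_step_bfgs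
begin

text \<open>The mean value inequality for the gradient minus the linear map given by the Hessian at
  \<open>zs\<close>.\<close>

lemma hess_secant_error:
  assumes lip: "C-lipschitz_on (cball zs r \<inter> U) (hess F)" and near: "\<And>k. z k \<in> cball zs r"
  shows "norm (ydiff F z k - hess F zs *v sdiff z k)
    \<le> C * (norm (z k - zs) + norm (z (Suc k) - zs)) * norm (sdiff z k)"
proof -
  define R where "R = norm (z k - zs) + norm (z (Suc k) - zs)"
  \<comment> \<open>The extra ball of radius R makes the Hessian deviate by at most C R. An
    intersection of convex sets, S contains the segment along with both iterates.\<close>
  define S where "S = cball zs r \<inter> U \<inter> cball zs R"
  have "convex S"
    unfolding S_def by (intro convex_Int convex_cball convex_U)
  moreover have zS: "z k \<in> S" "z (Suc k) \<in> S"
    using near z_in_U by (auto simp: S_def R_def dist_norm norm_minus_commute)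
  moreover have "((\<lambda>u. grad F u - hess F zs *v u) has_derivative (\<lambda>h. (hess F u - hess F zs) *v h)) (at u within S)"
    if "u \<in> S" for u
  proof -
    have "((\<lambda>u. grad F u - hess F zs *v u) has_derivative (\<lambda>h. hess F u *v h - hess F zs *v h)) (at u within S)"
      using that by (intro has_derivative_diff has_derivative_at_withinI[OF grad_has_derivative]
          bounded_linear.has_derivative[OF matrix_vector_mul_bounded_linear] has_derivative_ident)
        (simp add: S_def)
    then show ?thesis
      by (simp add: matrix_vector_mult_diff_rdistrib)
  qed
  moreover have "onorm (\<lambda>h. (hess F u - hess F zs) *v h) \<le> C * R" if "u \<in> S" for u
  proof (rule onorm_le)
    fix h
    have "zs \<in> cball zs r"
      using near[of 0] by (simp add: order_trans[OF zero_le_dist])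
    then have "dist (hess F u) (hess F zs) \<le> C * dist u zs"
      using that zs_in_U by (intro lipschitz_onD[OF lip]) (auto simp: S_def)
    also have "\<dots> \<le> C * R"
      using that lipschitz_on_nonneg[OF lip] by (intro mult_left_mono) (auto simp: S_def dist_commute)
    finally have "norm (hess F u - hess F zs) \<le> C * R"
      by (simp add: dist_norm)
    then show "norm ((hess F u - hess F zs) *v h) \<le> C * R * norm h"
      by (intro order_trans[OF norm_matrix_vec_le] mult_right_mono) auto
  qed
  ultimately have "norm ((grad F (z (Suc k)) - hess F zs *v z (Suc k)) - (grad F (z k) - hess F zs *v z k))
      \<le> C * R * norm (z (Suc k) - z k)"
    by (intro differentiable_bound[of S]) auto
  then show ?thesis
    by (simp add: R_def ydiff_def sdiff_def matrix_vector_mult_diff_distrib algebra_simps)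
qed

text \<open>Since B s = -g, the new gradient is y - B s = (y - G s) - (B - G) s. Both parts are
  o(|s|), the first by the secant error and the second by Dennis-More, and strong monotonicity turns
  the gradient into the error.\<close>

lemma q_superlinear_near:
  assumes lip: "C-lipschitz_on (cball zs r \<inter> U) (hess F)" and near: "\<And>k. z k \<in> cball zs r"
  shows "q_superlinear z zs"
proof -
  define e where "e k = norm (z k - zs)" for k
  define \<epsilon> where "\<epsilon> k = C * (e k + e (Suc k))" for k
  define q where "q k = norm (B k *v sdiff z k - hess F zs *v sdiff z k) / norm (sdiff z k)" for k
  define p where "p k = (\<epsilon> k + q k) / m" for k
  have summ: "summable e" "summable (\<lambda>k. e (Suc k))"
    using summable_error by (simp_all add: e_def[abs_def] summable_Suc_iff[of "\<lambda>k. norm (z k - zs)"])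
  then have eps: "summable \<epsilon>"
    unfolding \<epsilon>_def by (intro summable_mult summable_add)
  have secant: "norm (ydiff F z k - hess F zs *v sdiff z k) \<le> \<epsilon> k * norm (sdiff z k)" for k
    unfolding \<epsilon>_def e_def by (rule hess_secant_error[OF lip near])
  have "q \<longlonglongrightarrow> 0"
    unfolding q_def
    by (rule dennis_more[OF hess_sym[OF zs_in_U] hess_lower[OF zs_in_U] norm_hess_le[OF zs_in_U] secant eps])
  then have "(\<lambda>k. (\<epsilon> k + q k) / m) \<longlonglongrightarrow> (0 + 0) / m"
    using m_pos by (intro tendsto_intros summable_LIMSEQ_zero[OF eps]) auto
  then have p_lim: "p \<longlonglongrightarrow> 0"
    by (simp add: p_def[abs_def])
  \<comment> \<open>A nonzero gradient keeps every iterate away from \<open>zs\<close>, so the error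
    ratios are genuine quotients.\<close>
  have e_pos: "0 < e k" for k
    using grad_nonzero[of k] stationary by (auto simp: e_def)
  have e_Suc: "e (Suc k) \<le> p k * (e k + e (Suc k))" for k
  proof -
    define v where "v = ydiff F z k - hess F zs *v sdiff z k"
    define w where "w = B k *v sdiff z k - hess F zs *v sdiff z k"
    have "grad F (z (Suc k)) = v - w"
      by (simp add: v_def w_def B_sdiff ydiff_def)
    then have "m * e (Suc k) \<le> norm v + norm w"
      using norm_grad_ge[of "Suc k"] norm_triangle_ineq4[of v w] by (simp add: e_def)
    also have "\<dots> \<le> \<epsilon> k * norm (sdiff z k) + q k * norm (sdiff z k)"
      using secant[of k] sdiff_nonzero[of k] by (simp add: v_def w_def q_def)
    also have "\<dots> = m * (p k * norm (sdiff z k))"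
      using m_pos by (simp add: p_def distrib_right)
    finally have "e (Suc k) \<le> p k * norm (sdiff z k)"
      using m_pos by simp
    also have "\<dots> \<le> p k * (e k + e (Suc k))"
    proof (rule mult_left_mono)
      show "norm (sdiff z k) \<le> e k + e (Suc k)"
        using norm_triangle_ineq4[of "z (Suc k) - zs" "z k - zs"] by (simp add: sdiff_def e_def)
      show "0 \<le> p k"
        using m_pos lipschitz_on_nonneg[OF lip] by (simp add: p_def \<epsilon>_def q_def e_def)
    qed
    finally show ?thesis .
  qed
  \<comment> \<open>As |s| is bounded by the sum of both errors, the new error occurs on the right
    as well; it is absorbed on the left once p k < 1.\<close>
  have ev: "\<forall>\<^sub>F k in sequentially. e (Suc k) / e k \<le> p k / (1 - p k)"
  proof -
    have "\<forall>\<^sub>F k in sequentially. p k < 1"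
      using order_tendstoD(2)[OF p_lim] by simp
    then show ?thesis
    proof (rule eventually_mono)
      fix k assume "p k < 1"
      moreover have "(1 - p k) * e (Suc k) \<le> p k * e k"
        using e_Suc[of k] by (simp add: algebra_simps)
      ultimately show "e (Suc k) / e k \<le> p k / (1 - p k)"
        using e_pos[of k] by (simp add: field_simps)
    qed
  qed
  have "(\<lambda>k. p k / (1 - p k)) \<longlonglongrightarrow> 0 / (1 - 0)"
    by (intro tendsto_intros p_lim) simp
  then have lim: "(\<lambda>k. p k / (1 - p k)) \<longlonglongrightarrow> 0"
    by simp
  have "(\<lambda>k. e (Suc k) / e k) \<longlonglongrightarrow> 0"
    by (rule tendsto_sandwich[OF _ ev tendsto_const lim]) (simp add: e_def)
  then show ?thesis
    using z_tendsto by (simp add: q_superlinear_def e_def)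
qed

text \<open>The Lipschitz constant is available only in a ball around \<open>zs\<close>. After
  convergence has placed a tail in that ball, the whole analysis is repeated for the tail, with its
  first matrix as the initial one.\<close>

lemma unit_step_bfgs_shift: "unit_step_bfgs F U m M (\<lambda>k. z (k + K)) (\<lambda>k. H (k + K)) zs \<alpha>"
proof unfold_locales
  show "H (Suc k + K) = bfgs_update (H (k + K)) (sdiff (\<lambda>k. z (k + K)) k) (ydiff F (\<lambda>k. z (k + K)) k)" for k
    using H_Suc[of "k + K"] by (simp add: sdiff_def ydiff_def)
  show "z (Suc k + K) = z (k + K) + search_dir F (H (k + K)) (z (k + K))" for k
    using z_Suc[of "k + K"] by simp
qed (simp_all only: z_in_U zs_in_U stationary grad_nonzero H_pos alpha_pos decrease not_False_eq_True)

lemma q_superlinear: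
  assumes "locally_lipschitz_on U (hess F)"
  shows "q_superlinear z zs"
proof -
  obtain r C where r: "r > 0" and lip: "C-lipschitz_on (cball zs r \<inter> U) (hess F)"
    using assms zs_in_U unfolding locally_lipschitz_on_def by blast
  have "\<forall>\<^sub>F k in sequentially. dist (z k) zs < r"
    using z_tendsto r by (rule tendstoD)
  then obtain K where "\<And>k. K \<le> k \<Longrightarrow> dist (z k) zs < r"
    by (auto simp: eventually_sequentially)
  then have near: "z (k + K) \<in> cball zs r" for k
    by (simp add: dist_commute less_imp_le)
  have "q_superlinear (\<lambda>k. z (k + K)) zs"
    by (rule unit_step_bfgs.q_superlinear_near[OF unit_step_bfgs_shift lip near])
  then show ?thesis
    by (rule q_superlinear_offset)
qed

end

section \<open>The modified method\<close>

lemma curv_threshold_nonneg: "0 < mcur \<Longrightarrow> 0 \<le> curv_threshold mcur Mcur s y"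
  by (simp add: curv_threshold_def le_max_iff_disj)

text \<open>Every correction reverses the sign of the curvature, s \<bullet> yt = -c, and is applied
  only when c is negative. Negative c also excludes s = 0, so the divisions in modes E and H are
  proper.\<close>

lemma used_y_curvature_pos:
  assumes B: "pos_def B" and mcur: "0 < mcur" and yt: "used_y md mcur Mcur B s y = Some yt"
  shows "0 < s \<bullet> yt"
proof (cases "direct_test mcur Mcur s y")
  case True
  then show ?thesis
    using yt curv_threshold_nonneg[OF mcur, of Mcur s y] by (simp add: used_y_def direct_test_def)
next
  case False
  define c \<eta> where "c = s \<bullet> y" and "\<eta> = curv_threshold mcur Mcur s y"
  have \<eta>: "0 \<le> \<eta>" unfolding \<eta>_def by (rule curv_threshold_nonneg[OF mcur])
  show ?thesis
  proof (cases md)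
    case ModeN
    then show ?thesis
      using yt False \<eta> by (auto simp: used_y_def Let_def c_def[symmetric] \<eta>_def[symmetric] split: if_splits)
  next
    case ModeE
    then have c: "c < - \<eta>" and y: "yt = y - (2 * c / (s \<bullet> s)) *\<^sub>R s"
      using yt False by (auto simp: used_y_def Let_def c_def[symmetric] \<eta>_def[symmetric] split: if_splits)
    have "s \<noteq> 0" using c \<eta> by (auto simp: c_def)
    then have "s \<bullet> yt = - c"
      by (simp add: y inner_diff_right c_def[symmetric])
    then show ?thesis using c \<eta> by simp
  next
    case ModeH
    then have c: "c < - (mcur * (norm s)\<^sup>2)" and y: "yt = y - (2 * c / (s \<bullet> (B *v s))) *\<^sub>R (B *v s)"
      using yt False by (auto simp: used_y_def Let_def c_def[symmetric] \<eta>_def[symmetric] split: if_splits)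
    have "0 \<le> mcur * (norm s)\<^sup>2" using mcur by simp
    then have c0: "c < 0" using c by linarith
    then have "s \<noteq> 0" by (auto simp: c_def)
    then have "s \<bullet> (B *v s) \<noteq> 0" using B by (auto simp: pos_def_def)
    then have "s \<bullet> yt = - c"
      by (simp add: y inner_diff_right c_def[symmetric])
    then show ?thesis using c0 by simp
  qed
qed

text \<open>The induction hypothesis is used twice: for the update itself, and for the correction in
  mode H, which divides by s \<bullet> B s with B the inverse of the current matrix.\<close>

lemma bfgs_run_pos_def:
  assumes run: "bfgs_run md F \<alpha> \<beta> mcur Mcur z0 H0 z H j" and H0: "pos_def H0" and mcur: "0 < mcur"
  shows "pos_def (H k)"
proof (induction k)
  case 0
  then show ?case using run H0 by (simp add: bfgs_run_def)
next
  case (Suc k)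
  have "H (Suc k) = (case used_y md mcur Mcur (matrix_inv (H k)) (sdiff z k) (ydiff F z k) of
      None \<Rightarrow> H k | Some yt \<Rightarrow> bfgs_update (H k) (sdiff z k) yt)"
    using run unfolding bfgs_run_def by blast
  then show ?case
    using Suc.IH used_y_curvature_pos[OF pos_def_matrix_inv[OF Suc.IH] mcur]
    by (auto split: option.splits intro: pos_def_bfgs_update)
qed

section \<open>The preconditioner and the smoothed objective\<close>

text \<open>The term \<delta> I gives strictness; the other two summands add nonnegative forms, the
  last one being the diagonal form evaluated at J v.\<close>

lemma pos_def_precond:
  fixes z :: "real^('n::finite option)"
  assumes "0 < \<tau>" "0 < \<delta>" "\<And>i. 0 \<le> L i"
  shows "pos_def (precond f L \<delta> \<tau> z)"
  unfolding pos_def_def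
proof (intro conjI allI impI)
  have "transpose Pi_x = (Pi_x :: real^('n option)^('n option))"
    by (auto simp: Pi_x_def transpose_def vec_eq_iff)
  moreover have "transpose (Dhyp f \<tau> z) = Dhyp f \<tau> z"
    by (auto simp: Dhyp_def transpose_def vec_eq_iff)
  ultimately show "transpose (precond f L \<delta> \<tau> z) = precond f L \<delta> \<tau> z"
    by (simp add: precond_def transpose_add transpose_scaleR matrix_transpose_mul matrix_mul_assoc)
  fix v :: "real^('n option)"
  assume "v \<noteq> 0"
  define w where "w = Jmat f z *v v"
  have "(v \<bullet> (Pi_x *v v)) = (\<Sum>i\<in>UNIV. v $ i * (if i \<noteq> None then v $ i else 0))"
    by (auto simp: inner_vec_def Pi_x_def matrix_vector_mult_def if_distrib if_distribR cong: if_cong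
        intro!: sum.cong)
  also have "\<dots> \<ge> 0" by (intro sum_nonneg) auto
  finally have Pi: "0 \<le> v \<bullet> (Pi_x *v v)" .
  have "w \<bullet> (Dhyp f \<tau> z *v w) = (\<Sum>i\<in>UNIV. inverse (omega (f i) \<tau> z) * (w $ i)\<^sup>2)"
    by (simp add: inner_vec_def Dhyp_def matrix_vector_mult_def if_distrib if_distribR
        power2_eq_square mult_ac cong: if_cong)
  also have "\<dots> \<ge> 0"
    by (intro sum_nonneg) (simp add: omega_def)
  finally have D: "0 \<le> w \<bullet> (Dhyp f \<tau> z *v w)" .
  have "v \<bullet> (precond f L \<delta> \<tau> z *v v) = \<delta> * (v \<bullet> v) + (\<Sum>i\<in>UNIV. L i) * (v \<bullet> (Pi_x *v v))
      + 1 / 2 * (w \<bullet> (Dhyp f \<tau> z *v w))"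
    by (simp add: precond_def matrix_vector_mult_add_rdistrib scaleR_matrix_vector_assoc[symmetric]
        inner_add_right matrix_vector_mul_assoc[symmetric] inner_matrix_vec_transpose[of v "transpose _"] w_def
        del: transpose_matrix_vector)
  moreover have "0 < \<delta> * (v \<bullet> v)" using assms \<open>v \<noteq> 0\<close> by simp
  moreover have "0 \<le> (\<Sum>i\<in>UNIV. L i) * (v \<bullet> (Pi_x *v v))"
    using assms Pi by (intro mult_nonneg_nonneg sum_nonneg) auto
  ultimately show "0 < v \<bullet> (precond f L \<delta> \<tau> z *v v)"
    using D by linarith
qed

lemma phi_differentiable:
  assumes "0 < \<tau>"
  shows "phi \<tau> differentiable (at r)"
proof -
  have "0 < r\<^sup>2 + \<tau>\<^sup>2" using assms by (simp add: add_nonneg_pos)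
  then have "((\<lambda>r. (r + sqrt (r\<^sup>2 + \<tau>\<^sup>2)) / 2) has_real_derivative
      (1 + inverse (sqrt (r\<^sup>2 + \<tau>\<^sup>2)) / 2 * (2 * r)) / 2) (at r)"
    by (auto intro!: derivative_eq_intros)
  then show ?thesis
    unfolding phi_def[abs_def] by (auto simp: real_differentiable_def)
qed

lemma Phi_differentiable:
  assumes "\<And>i x. f i differentiable (at x)" "0 < \<tau>"
  shows "Phi f \<tau> differentiable (at z)"
proof -
  have t: "tpart differentiable (at z)" for z :: "real^('n::finite option)"
    unfolding tpart_def[abs_def] by (intro bounded_linear_imp_differentiable bounded_linear_vec_nth)
  have x: "xpart differentiable (at z)" for z :: "real^('n::finite option)"
    by (intro bounded_linear_imp_differentiable linear_conv_bounded_linear[THEN iffD1] linearI)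
      (auto simp: xpart_def vec_eq_iff)
  have "(\<lambda>z. f i (xpart z) - tpart z) differentiable (at z)" for i z
    by (intro differentiable_diff t differentiable_chain_at[of xpart z "f i", unfolded o_def] x assms(1))
  then have "(\<lambda>z. phi \<tau> (f i (xpart z) - tpart z)) differentiable (at z)" for i z
    using differentiable_chain_at[of "\<lambda>z. f i (xpart z) - tpart z" z "phi \<tau>", unfolded o_def]
      phi_differentiable[OF assms(2)] by blast
  then show ?thesis
    unfolding Phi_def[abs_def] by (intro differentiable_add differentiable_sum t) auto
qed

theorem proposition9p3:
  fixes f :: "'m::finite \<Rightarrow> real^'n \<Rightarrow> real"
    and L :: "'m \<Rightarrow> real"
    and S :: "(real^'n) set"
    and U :: "(real^('n option)) set"
    and z0 zs :: "real^('n option)"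
    and z :: "nat \<Rightarrow> real^('n option)"
    and H :: "nat \<Rightarrow> real^('n option)^('n option)"
    and j :: "nat \<Rightarrow> nat"
    and md :: bfgs_mode
    and \<tau> \<delta> \<chi>0 \<alpha> \<beta> mcur Mcur mPhi MPhi :: real
  assumes f_diff: "\<And>i x. f i differentiable (at x)"
    and tau: "0 < \<tau>"
    and delta: "0 < \<delta>"
    and chi0: "0 < \<chi>0"
    and alpha: "0 < \<alpha>" "\<alpha> < 1"
    and beta: "0 < \<beta>" "\<beta> < 1"
    and cur: "0 < mcur" "mcur < Mcur"
    and run: "bfgs_run md (Phi f \<tau>) \<alpha> \<beta> mcur Mcur z0
                (\<chi>0 *\<^sub>R matrix_inv (precond f L \<delta> \<tau> z0)) z H j"
    and L_nonneg: "\<And>i. 0 \<le> L i"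
    and L_lipschitz: "\<And>i. (L i)-lipschitz_on S (grad (f i))"
    and S_iterates: "\<And>k. xpart (z k) \<in> S"
    and S_trials: "\<And>k. xpart ` trial_segments (Phi f \<tau>) \<beta> z H j k \<subseteq> S"
    and U_nhd: "convex U" "zs \<in> interior U"
    and stationary: "grad (Phi f \<tau>) zs = 0"
    and mM: "0 < mPhi" "mPhi \<le> MPhi"
    and twice_diff: "\<And>u. u \<in> U \<Longrightarrow> grad (Phi f \<tau>) differentiable (at u)"
    and hess_bounds: "\<And>u. u \<in> U \<Longrightarrow>
          loewner_le (mPhi *\<^sub>R mat 1) (hess (Phi f \<tau>) u)
          \<and> loewner_le (hess (Phi f \<tau>) u) (MPhi *\<^sub>R mat 1)"
    and hess_lipschitz: "locally_lipschitz_on U (hess (Phi f \<tau>))"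
    and eventually_in_U: "\<forall>\<^sub>F k in sequentially. z k \<in> U
          \<and> trial_segments (Phi f \<tau>) \<beta> z H j k \<subseteq> U
          \<and> closed_segment (z k) (z (Suc k)) \<subseteq> U"
    and mcur_small: "mcur < mPhi"
    and Mcur_large: "Mcur > MPhi\<^sup>2 / mPhi"
  shows "(\<forall>\<^sub>F k in sequentially.
            direct_test mcur Mcur (sdiff z k) (ydiff (Phi f \<tau>) z k)
            \<and> correction_inactive md (Phi f \<tau>) mcur Mcur z H k)
       \<and> ((\<forall>\<^sub>F k in sequentially. \<beta> ^ j k = 1) \<longrightarrow> q_superlinear z zs)"
proof -
  define F where "F = Phi f \<tau>"
  interpret strongly_convex_region F U mPhi MPhi
  proof unfold_locales
    show "F differentiable (at u)" for u
      unfolding F_def by (rule Phi_differentiable[OF f_diff tau])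
  qed (fact U_nhd(1) twice_diff[folded F_def] hess_bounds[folded F_def] mM)+
  note run' = run[folded F_def, unfolded bfgs_run_def]
  have H_pos: "pos_def (H k)" for k
    by (rule bfgs_run_pos_def[OF run _ cur(1)])
      (intro pos_def_scaleR pos_def_matrix_inv pos_def_precond tau delta L_nonneg chi0)
  have grad_nonzero: "grad F (z k) \<noteq> 0" for k
    using run' by blast
  have z_Suc: "z (Suc k) = z k + \<beta> ^ j k *\<^sub>R search_dir F (H k) (z k)" for k
    using run' by blast
  have decrease: "armijo F \<alpha> (z k) (search_dir F (H k) (z k)) (\<beta> ^ j k)" for k
    using run' by blast
  have H_Suc: "H (Suc k) = (case used_y md mcur Mcur (matrix_inv (H k)) (sdiff z k) (ydiff F z k) of
        None \<Rightarrow> H k | Some yt \<Rightarrow> bfgs_update (H k) (sdiff z k) yt)" for k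
    using run' by blast
  \<comment> \<open>A positive definite matrix maps the nonzero gradient to a nonzero direction, and
    the step length is a power of the positive \<open>\<beta>\<close>.\<close>
  have "z k \<noteq> z (Suc k)" for k
    using pos_def_kernel[OF H_pos, of k "grad F (z k)"]
      grad_nonzero[of k] beta(1) by (auto simp: z_Suc search_dir_def)
  then have test: "direct_test mcur Mcur (sdiff z k) (ydiff F z k)"
    if "closed_segment (z k) (z (Suc k)) \<subseteq> U" for k
    unfolding sdiff_def ydiff_def
    by (intro direct_test_holds subsetD[OF that] ends_in_segment cur(1) mcur_small Mcur_large)
  \<comment> \<open>In every mode the direct test is the first branch, so passing it already selects
    the uncorrected y.\<close>
  then have used: "used_y md mcur Mcur (matrix_inv (H k)) (sdiff z k) (ydiff F z k) = Some (ydiff F z k)"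
    if "closed_segment (z k) (z (Suc k)) \<subseteq> U" for k
    using that by (simp add: used_y_def)
  obtain K where K: "\<And>k. K \<le> k \<Longrightarrow> closed_segment (z k) (z (Suc k)) \<subseteq> U"
    using eventually_in_U by (auto simp: eventually_sequentially)
  have "\<forall>\<^sub>F k in sequentially. direct_test mcur Mcur (sdiff z k) (ydiff F z k)
      \<and> correction_inactive md F mcur Mcur z H k"
    unfolding correction_inactive_def eventually_sequentially using test used K by blast
  moreover have "q_superlinear z zs" if unit_steps: "\<forall>\<^sub>F k in sequentially. \<beta> ^ j k = 1"
  proof -
    obtain N where N: "\<And>k. N \<le> k \<Longrightarrow> \<beta> ^ j k = 1"
      using unit_steps unfolding eventually_sequentially by blast
    define n where "n = max K N"
    have seg: "closed_segment (z (k + n)) (z (Suc (k + n))) \<subseteq> U" and unit: "\<beta> ^ j (k + n) = 1" for k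
      using K[of "k + n"] N[of "k + n"] by (auto simp: n_def)
    \<comment> \<open>The tail starts from whatever matrix the earlier updates, corrected ones
      included, have produced; the invariant \<open>H_pos\<close> makes it an admissible
      start.\<close>
    interpret unit_step_bfgs F U mPhi MPhi "\<lambda>k. z (k + n)" "\<lambda>k. H (k + n)" zs \<alpha>
    proof unfold_locales
      show "z (k + n) \<in> U" for k using seg[of k] by auto
      show "zs \<in> U" using U_nhd(2) interior_subset by blast
      show "grad F zs = 0" using stationary by (simp add: F_def)
      show "z (Suc k + n) = z (k + n) + search_dir F (H (k + n)) (z (k + n))" for k
        using z_Suc[of "k + n"] by (simp add: unit)
      show "H (Suc k + n) = bfgs_update (H (k + n)) (sdiff (\<lambda>k. z (k + n)) k) (ydiff F (\<lambda>k. z (k + n)) k)" for k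
        using H_Suc[of "k + n"] used[OF seg, of k] by (simp add: sdiff_def ydiff_def)
      show "armijo F \<alpha> (z (k + n)) (search_dir F (H (k + n)) (z (k + n))) 1" for k
        using decrease[of "k + n"] by (simp add: unit)
    qed (fact grad_nonzero H_pos alpha(1))+
    have "q_superlinear (\<lambda>k. z (k + n)) zs"
      by (rule q_superlinear) (use hess_lipschitz in \<open>simp add: F_def\<close>)
    then show ?thesis
      by (rule q_superlinear_offset)
  qed
  ultimately show ?thesis
    by (simp add: F_def)
qed

end
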